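(* Let $\Phi,\Psi$ be invertible $N_x\times N_x$ matrices with $\|\Phi^q\|<1$, $\|\Psi^q\|<1$ for some $q\ge1$ (fine- and coarse-grid time-stepping operators), with coarsening factor $k$ and $N_c$ coarse-grid time points. Assume $\Phi$ and $\Psi$ commute and are diagonalizable with common eigenvectors given as the columns of $U$ and corresponding eigenvalues $\lambda_i$ of $\Phi$ and $\mu_i$ of $\Psi$. Then the matrix norm inequality $\|M\|_2^2\le\|M\|_1\|M\|_\infty$ is asymptotically exact for $[I-A_\Delta B_\Delta^{-1}]_i$ and $[(I-A_\Delta B_\Delta^{-1})A_{cf}A_{ff}^{-1}A_{fc}]_i$, for each $i$; that is, $$\lim_{N_c\to\infty}\big\|[I-A_\Delta B_\Delta^{-1}]_i\big\|_2^2=\lim_{N_c\to\infty}\big\|[I-A_\Delta B_\Delta^{-1}]_i\big\|_1\big\|[I-A_\Delta B_\Delta^{-1}]_i\big\|_\infty,$$ and likewise for $[(I-A_\Delta B_\Delta^{-1})A_{cf}A_{ff}^{-1}A_{fc}]_i$. Moreover, for $p\ge1$, $$\lim_{N_c\to\infty}\|(I-A_\Delta B_\Delta^{-1})^p\|_{(UU^* )^{-1}}=\lim_{N_c\to\infty}\|I-A_\Delta B_\Delta^{-1}\|_{(UU^* )^{-1}}^p=\left(\sup_i\frac{|\mu_i-\lambda_i^k|}{1-|\mu_i|}\right)^p,$$ $$\lim_{N_c\to\infty}\left\|\left((I-A_\Delta B_\Delta^{-1})A_{cf}A_{ff}^{-1}A_{fc}\right)^p\right\|_{(UU^* )^{-1}}=\lim_{N_c\to\infty}\left\|(I-A_\Delta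 B_\Delta^{-1})A_{cf}A_{ff}^{-1}A_{fc}\right\|_{(UU^* )^{-1}}^p=\left(\sup_i\frac{|\lambda_i^k||\mu_i-\lambda_i^k|}{1-|\mu_i|}\right)^p.$$
   Context: $A_\Delta$ and $B_\Delta$ are the $N_c\times N_c$ block matrices (blocks of size $N_x\times N_x$) with identity blocks on the diagonal, zeros elsewhere except on the first block subdiagonal, where $A_\Delta$ has $-\Phi^k$ and $B_\Delta$ has $-\Psi$. $A_{cf}A_{ff}^{-1}A_{fc}$ is the $N_c\times N_c$ block matrix with $\Phi^k$ on the first block subdiagonal and zeros elsewhere. For $\mathcal{M}=I-A_\Delta B_\Delta^{-1}$ or $\mathcal{M}=(I-A_\Delta B_\Delta^{-1})A_{cf}A_{ff}^{-1}A_{fc}$, which are $N_c\times N_c$ block matrices whose blocks are polynomials in $\Phi$ and $\Psi$, $[\mathcal{M}]_i$ denotes the scalar $N_c\times N_c$ matrix obtained by replacing $\Phi$ by $\lambda_i$, $\Psi$ by $\mu_i$ and identity blocks by $1$. $\|\cdot\|_1,\|\cdot\|_2,\|\cdot\|_\infty$ are the matrix norms induced by the $\ell^1,\ell^2,\ell^\infty$ vector norms. For a block vector $\mathbf{x}$ with blocks $\mathbf{x}_j\in\mathbb{C}^{N_x}$, $\|\mathbf{x}\|_{(UU^* )^{-1}}^2=\sum_j\|U^{-1}\mathbf{x}_j\|^2$, with the induced operator norm on block matrices. *)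

theory Defs
  imports
    Complex_Main
    "HOL-Analysis.L2_Norm"
    "Jordan_Normal_Form.Gauss_Jordan_Elimination"
    "Jordan_Normal_Form.Char_Poly"
begin

definition vnorm1 :: "complex vec \<Rightarrow> real" where
  "vnorm1 v = (\<Sum>i<dim_vec v. cmod (v $ i))"

definition vnorm2 :: "complex vec \<Rightarrow> real" where
  "vnorm2 v = L2_set (\<lambda>i. cmod (v $ i)) {..<dim_vec v}"

definition vnorm_inf :: "complex vec \<Rightarrow> real" where
  "vnorm_inf v = (SUP i\<in>{..<dim_vec v}. cmod (v $ i))"

(* Only meaningful for matrices with at least one column, since the supremum of
   the empty set of reals is unspecified. *)
definition induced_norm :: "(complex vec \<Rightarrow> real) \<Rightarrow> complex mat \<Rightarrow> real" where
  "induced_norm \<nu> A =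
     (SUP v\<in>{v \<in> carrier_vec (dim_col A). v \<noteq> 0\<^sub>v (dim_col A)}. \<nu> (A *\<^sub>v v) / \<nu> v)"

abbreviation mnorm1 :: "complex mat \<Rightarrow> real" where
  "mnorm1 \<equiv> induced_norm vnorm1"

abbreviation mnorm2 :: "complex mat \<Rightarrow> real" where
  "mnorm2 \<equiv> induced_norm vnorm2"

abbreviation mnorm_inf :: "complex mat \<Rightarrow> real" where
  "mnorm_inf \<equiv> induced_norm vnorm_inf"

(* mat_inverse returns None for singular matrices; below the inverse is only
   taken of invertible ones (U, and the unit lower triangular B_Delta). *)
abbreviation minv :: "complex mat \<Rightarrow> complex mat" where
  "minv A \<equiv> the (mat_inverse A)"

(* A block matrix with Nc x Nc blocks of size n x n is stored flat: block (a, b)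
   occupies rows a * n ..< (a + 1) * n and columns b * n ..< (b + 1) * n.
   This one has D on the block diagonal, S on the first block subdiagonal. *)
definition block_bidiag :: "nat \<Rightarrow> complex mat \<Rightarrow> complex mat \<Rightarrow> complex mat" where
  "block_bidiag Nc D S =
     (let n = dim_row D in
      mat (Nc * n) (Nc * n) (\<lambda>(r, c).
        if r div n = c div n then D $$ (r mod n, c mod n)
        else if r div n = Suc (c div n) then S $$ (r mod n, c mod n)
        else 0))"

definition A_Delta :: "nat \<Rightarrow> nat \<Rightarrow> complex mat \<Rightarrow> complex mat" where
  "A_Delta Nc k \<Phi> = block_bidiag Nc (1\<^sub>m (dim_row \<Phi>)) (- (\<Phi> ^\<^sub>m k))"

definition B_Delta :: "nat \<Rightarrow> complex mat \<Rightarrow> complex mat" where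
  "B_Delta Nc \<Psi> = block_bidiag Nc (1\<^sub>m (dim_row \<Psi>)) (- \<Psi>)"

(* Directly the product A_cf A_ff^(-1) A_fc; its three factors are not modelled. *)
definition A_cf_ff_fc :: "nat \<Rightarrow> nat \<Rightarrow> complex mat \<Rightarrow> complex mat" where
  "A_cf_ff_fc Nc k \<Phi> = block_bidiag Nc (0\<^sub>m (dim_row \<Phi>) (dim_row \<Phi>)) (\<Phi> ^\<^sub>m k)"

definition coarse_err :: "nat \<Rightarrow> nat \<Rightarrow> complex mat \<Rightarrow> complex mat \<Rightarrow> complex mat" where
  "coarse_err Nc k \<Phi> \<Psi> =
     1\<^sub>m (Nc * dim_row \<Phi>) - A_Delta Nc k \<Phi> * minv (B_Delta Nc \<Psi>)"

definition fine_err :: "nat \<Rightarrow> nat \<Rightarrow> complex mat \<Rightarrow> complex mat \<Rightarrow> complex mat" where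
  "fine_err Nc k \<Phi> \<Psi> = coarse_err Nc k \<Phi> \<Psi> * A_cf_ff_fc Nc k \<Phi>"

definition scalar_block :: "complex \<Rightarrow> complex mat" where
  "scalar_block a = mat 1 1 (\<lambda>_. a)"

(* The scalar Nc x Nc matrices [M]_i: the same expressions with the block size
   n = 1, Phi replaced by the eigenvalue l and Psi by the eigenvalue m (so that
   identity blocks become 1); see the lemmas A_Delta_scalar, B_Delta_scalar, A_cf_ff_fc_scalar. *)
definition coarse_err_at :: "nat \<Rightarrow> nat \<Rightarrow> complex \<Rightarrow> complex \<Rightarrow> complex mat" where
  "coarse_err_at Nc k l m = coarse_err Nc k (scalar_block l) (scalar_block m)"

definition fine_err_at :: "nat \<Rightarrow> nat \<Rightarrow> complex \<Rightarrow> complex \<Rightarrow> complex mat" where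
  "fine_err_at Nc k l m = fine_err Nc k (scalar_block l) (scalar_block m)"

lemma scalar_block_pow: "scalar_block a ^\<^sub>m k = scalar_block (a ^ k)"
proof (induction k)
  case 0
  show ?case by (rule eq_matI) (auto simp: scalar_block_def)
next
  case (Suc k)
  then show ?case
    by (intro eq_matI) (auto simp: scalar_block_def scalar_prod_def mult.commute)
qed

lemma A_Delta_scalar:
  "A_Delta Nc k (scalar_block l) =
     mat Nc Nc (\<lambda>(r, c). if r = c then 1 else if r = Suc c then - (l ^ k) else 0)"
  by (rule eq_matI)
    (auto simp: A_Delta_def block_bidiag_def scalar_block_pow, auto simp: scalar_block_def)

lemma B_Delta_scalar:
  "B_Delta Nc (scalar_block m) =
     mat Nc Nc (\<lambda>(r, c). if r = c then 1 else if r = Suc c then - m else 0)"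
  by (rule eq_matI) (auto simp: B_Delta_def block_bidiag_def scalar_block_def)

lemma A_cf_ff_fc_scalar:
  "A_cf_ff_fc Nc k (scalar_block l) =
     mat Nc Nc (\<lambda>(r, c). if r = Suc c then l ^ k else 0)"
  by (rule eq_matI)
    (auto simp: A_cf_ff_fc_def block_bidiag_def scalar_block_pow, auto simp: scalar_block_def)

definition vec_block :: "nat \<Rightarrow> complex vec \<Rightarrow> nat \<Rightarrow> complex vec" where
  "vec_block n x j = vec n (\<lambda>r. x $ (j * n + r))"

(* The norm with weight (U U^H)^(-1), U^H the conjugate transpose of U, for block
   vectors with blocks of size dim_row U. *)
definition vnorm_U :: "complex mat \<Rightarrow> complex vec \<Rightarrow> real" where
  "vnorm_U U x =
     sqrt (\<Sum>j<dim_vec x div dim_row U. (vnorm2 (minv U *\<^sub>v vec_block (dim_row U) x j))\<^sup>2)"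

abbreviation mnorm_U :: "complex mat \<Rightarrow> complex mat \<Rightarrow> real" where
  "mnorm_U U \<equiv> induced_norm (vnorm_U U)"

end

(* Block by block, conjugation with I (x) U turns both error matrices into lower triangular Toeplitz
   matrices with diagonal blocks, i.e. into power series in the shift: with l = lam i, m = mu i
   the coarse error has the symbol (l^k - m) X / (1 - m X), and the fine error that times l^k X.
   In such a series, and in its powers, the j-th coefficient has phase g u^j with u fixed.
   Hence no cancellation occurs when the Toeplitz matrix acts on the vector u^b, so that the
   induced 1-, 2- and infinity-norms all converge to the l^1-norm of the coefficients, which is
   multiplicative on such series. *)
theory Submission
  imports Defs "HOL-Computational_Algebra.Formal_Power_Series"
begin

subsection \<open>Induced norms\<close>

text \<open>For a fixed number N of blocks both error matrices are strictly block lower triangular,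
  so every power with exponent at least N vanishes; comparing norms of powers with powers of norms
  is a statement about N growing while the exponent stays fixed. The upper bounds hold for every N >
  0 and come from row and column sums. The obstacle is the lower bound for the 2-norm: the sequence
  \<open>u ^ b\<close> on which the phases align is not square summable. Cut off after N entries it
  has squared norm N, while the image coordinates from index m on have modulus at least the sum of
  the coefficient moduli up to m; the loss is a factor sqrt((N - m) / N), which tends to 1 for fixed
  m. The weight of the U-norm is the one that makes I (x) U an isometry from the plain 2-norm, so no
  condition number of U appears in the limits. After conjugation the n components decouple, and the
  largest of their n limits decides.\<close>

lemma induced_norm_le:
  assumes "dim_col A > 0" "K \<ge> 0"
    and nonneg: "\<And>v. v \<in> carrier_vec (dim_col A) \<Longrightarrow> \<nu> v \<ge> 0"
    and le: "\<And>v. v \<in> carrier_vec (dim_col A) \<Longrightarrow> \<nu> (A *\<^sub>v v) \<le> K * \<nu> v"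
  shows "induced_norm \<nu> A \<le> K"
  unfolding induced_norm_def
proof (rule cSUP_least)
  let ?e = "unit_vec (dim_col A) 0 :: complex vec"
  have "?e $ 0 \<noteq> 0\<^sub>v (dim_col A) $ 0" using assms(1) by simp
  then have "?e \<noteq> 0\<^sub>v (dim_col A)" by metis
  then have "?e \<in> {v \<in> carrier_vec (dim_col A). v \<noteq> 0\<^sub>v (dim_col A)}" by simp
  then show "{v :: complex vec. v \<in> carrier_vec (dim_col A) \<and> v \<noteq> 0\<^sub>v (dim_col A)} \<noteq> {}"
    by blast
next
  fix v :: "complex vec" assume "v \<in> {v \<in> carrier_vec (dim_col A). v \<noteq> 0\<^sub>v (dim_col A)}"
  then have "\<nu> (A *\<^sub>v v) \<le> K * \<nu> v" "\<nu> v \<ge> 0" using le nonneg by blast+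
  \<comment> \<open>Where \<open>\<nu> v = 0\<close>, the quotient is 0 by the convention for
    division, and \<open>K \<ge> 0\<close> settles the case.\<close>
  then show "\<nu> (A *\<^sub>v v) / \<nu> v \<le> K"
    using assms(2) by (cases "\<nu> v = 0") (auto simp: divide_le_eq)
qed

text \<open>The constant \<open>K\<close> serves only to make the quotients bounded above, without
  which the supremum need not dominate them; any crude bound will do.\<close>

lemma induced_norm_ge:
  assumes "K \<ge> 0"
    and nonneg: "\<And>v. v \<in> carrier_vec (dim_col A) \<Longrightarrow> \<nu> v \<ge> 0"
    and le: "\<And>v. v \<in> carrier_vec (dim_col A) \<Longrightarrow> \<nu> (A *\<^sub>v v) \<le> K * \<nu> v"
    and v: "v \<in> carrier_vec (dim_col A)" "v \<noteq> 0\<^sub>v (dim_col A)"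
  shows "\<nu> (A *\<^sub>v v) / \<nu> v \<le> induced_norm \<nu> A"
  unfolding induced_norm_def
proof (rule cSUP_upper)
  show "v \<in> {v \<in> carrier_vec (dim_col A). v \<noteq> 0\<^sub>v (dim_col A)}" using v by blast
  show "bdd_above ((\<lambda>v. \<nu> (A *\<^sub>v v) / \<nu> v) `
      {v \<in> carrier_vec (dim_col A). v \<noteq> 0\<^sub>v (dim_col A)})"
  proof (rule bdd_aboveI2)
    fix v :: "complex vec" assume "v \<in> {v \<in> carrier_vec (dim_col A). v \<noteq> 0\<^sub>v (dim_col A)}"
    then have "\<nu> (A *\<^sub>v v) \<le> K * \<nu> v" "\<nu> v \<ge> 0" using le nonneg by blast+
    then show "\<nu> (A *\<^sub>v v) / \<nu> v \<le> K"
      using assms(1) by (cases "\<nu> v = 0") (auto simp: divide_le_eq)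
  qed
qed

text \<open>The substitution v = P y permutes the non-zero vectors and turns each quotient for
  \<open>A\<close> under \<open>\<nu>\<close> into one for \<open>B\<close> under
  \<open>\<nu>'\<close>. The two suprema thus range over the same set of values, so the equality
  also covers unbounded and empty sets, in particular d = 0.\<close>

lemma induced_norm_similar:
  assumes A: "A \<in> carrier_mat d d" and B: "B \<in> carrier_mat d d"
    and P: "P \<in> carrier_mat d d" and Q: "Q \<in> carrier_mat d d"
    and PQ: "P * Q = 1\<^sub>m d" and QP: "Q * P = 1\<^sub>m d"
    and AP: "A * P = P * B"
    and nu: "\<And>y. y \<in> carrier_vec d \<Longrightarrow> \<nu> (P *\<^sub>v y) = \<nu>' y"
  shows "induced_norm \<nu> A = induced_norm \<nu>' B"
proof -
  let ?S = "{v \<in> carrier_vec d. v \<noteq> 0\<^sub>v d} :: complex vec set"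
  have PQv: "P *\<^sub>v (Q *\<^sub>v v) = v" if "v \<in> carrier_vec d" for v
    using assoc_mult_mat_vec[OF P Q that] that by (simp add: PQ)
  have QPv: "Q *\<^sub>v (P *\<^sub>v v) = v" if "v \<in> carrier_vec d" for v
    using assoc_mult_mat_vec[OF Q P that] that by (simp add: QP)
  have P0: "P *\<^sub>v 0\<^sub>v d = 0\<^sub>v d" and Q0: "Q *\<^sub>v 0\<^sub>v d = 0\<^sub>v d"
    using P Q by auto
  have S: "?S = (\<lambda>v. P *\<^sub>v v) ` ?S"
  proof (intro equalityI subsetI)
    fix v assume "v \<in> ?S"
    then have v: "v \<in> carrier_vec d" "v \<noteq> 0\<^sub>v d" by blast+
    have "Q *\<^sub>v v \<in> carrier_vec d" using Q v(1) by (rule mult_mat_vec_carrier)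
    moreover have "Q *\<^sub>v v \<noteq> 0\<^sub>v d" using PQv[OF v(1)] P0 v(2) by metis
    ultimately have "Q *\<^sub>v v \<in> ?S" by blast
    then show "v \<in> (\<lambda>v. P *\<^sub>v v) ` ?S"
      by (intro image_eqI[of v "\<lambda>v. P *\<^sub>v v" "Q *\<^sub>v v"] PQv[OF v(1), symmetric])
  next
    fix v assume "v \<in> (\<lambda>v. P *\<^sub>v v) ` ?S"
    then obtain y where y: "y \<in> carrier_vec d" "y \<noteq> 0\<^sub>v d" "v = P *\<^sub>v y" by blast
    have "v \<in> carrier_vec d" unfolding y(3) using P y(1) by (rule mult_mat_vec_carrier)
    moreover have "v \<noteq> 0\<^sub>v d" using QPv[OF y(1)] Q0 y(2,3) by metis
    ultimately show "v \<in> ?S" by blast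
  qed
  have "induced_norm \<nu> A = (SUP v\<in>?S. \<nu> (A *\<^sub>v v) / \<nu> v)"
    using A by (simp add: induced_norm_def)
  also have "\<dots> = (SUP v\<in>(\<lambda>v. P *\<^sub>v v) ` ?S. \<nu> (A *\<^sub>v v) / \<nu> v)"
    by (rule arg_cong[OF S, of "\<lambda>X. SUP v\<in>X. \<nu> (A *\<^sub>v v) / \<nu> v"])
  also have "\<dots> = (SUP y\<in>?S. \<nu> (A *\<^sub>v (P *\<^sub>v y)) / \<nu> (P *\<^sub>v y))"
    unfolding image_image ..
  also have "\<dots> = (SUP y\<in>?S. \<nu>' (B *\<^sub>v y) / \<nu>' y)"
  proof (rule SUP_cong[OF refl])
    fix y assume "y \<in> ?S"
    then have y: "y \<in> carrier_vec d" by simp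
    have "A *\<^sub>v (P *\<^sub>v y) = P *\<^sub>v (B *\<^sub>v y)"
      using assoc_mult_mat_vec[OF A P y] assoc_mult_mat_vec[OF P B y] AP by simp
    moreover have "B *\<^sub>v y \<in> carrier_vec d" using B y by auto
    ultimately show "\<nu> (A *\<^sub>v (P *\<^sub>v y)) / \<nu> (P *\<^sub>v y) = \<nu>' (B *\<^sub>v y) / \<nu>' y"
      using nu y by simp
  qed
  also have "\<dots> = induced_norm \<nu>' B" using B by (simp add: induced_norm_def)
  finally show ?thesis .
qed

section \<open>The Euclidean norm and its bound on eigenvalues\<close>

lemma vnorm2_nonneg: "vnorm2 v \<ge> 0"
  by (simp add: vnorm2_def)

lemma vnorm2_power2: "(vnorm2 v)\<^sup>2 = (\<Sum>i<dim_vec v. (cmod (v $ i))\<^sup>2)"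
  by (simp add: vnorm2_def L2_set_def sum_nonneg)

lemma vnorm2_smult: "vnorm2 (c \<cdot>\<^sub>v v) = cmod c * vnorm2 v"
  unfolding vnorm2_def by (auto simp: norm_mult L2_set_right_distrib intro!: L2_set_cong)

lemma vnorm2_eq_0_iff: "vnorm2 v = 0 \<longleftrightarrow> v = 0\<^sub>v (dim_vec v)"
  by (auto simp: vnorm2_def L2_set_eq_0_iff vec_eq_iff)

text \<open>A crude bound by the sum of all entries, made to supply the boundedness that
  \<open>induced_norm_ge\<close> asks for.\<close>

lemma vnorm2_mult_mat_vec_le:
  assumes "v \<in> carrier_vec (dim_col A)"
  shows "vnorm2 (A *\<^sub>v v) \<le> (\<Sum>i<dim_row A. \<Sum>j<dim_col A. cmod (A $$ (i, j))) * vnorm2 v"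
proof -
  have "cmod ((A *\<^sub>v v) $ i) \<le> (\<Sum>j<dim_col A. cmod (A $$ (i, j))) * vnorm2 v"
    if "i < dim_row A" for i
  proof -
    have "cmod ((A *\<^sub>v v) $ i) \<le> (\<Sum>j<dim_col A. cmod (A $$ (i, j) * v $ j))"
      using that assms by (auto simp: scalar_prod_def atLeast0LessThan intro!: sum_norm_le)
    also have "\<dots> \<le> (\<Sum>j<dim_col A. cmod (A $$ (i, j)) * vnorm2 v)"
      using assms
      by (intro sum_mono) (auto simp: norm_mult vnorm2_def intro!: mult_left_mono
          member_le_L2_set[of _ _ "\<lambda>i. cmod (v $ i)"])
    finally show ?thesis by (simp add: sum_distrib_right)
  qed
  then have "(\<Sum>i<dim_row A. cmod ((A *\<^sub>v v) $ i)) \<le>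
      (\<Sum>i<dim_row A. (\<Sum>j<dim_col A. cmod (A $$ (i, j))) * vnorm2 v)"
    by (intro sum_mono) auto
  moreover have "vnorm2 (A *\<^sub>v v) \<le> (\<Sum>i<dim_row A. cmod ((A *\<^sub>v v) $ i))"
    unfolding vnorm2_def dim_mult_mat_vec by (rule L2_set_le_sum) simp
  ultimately show ?thesis by (simp add: sum_distrib_right)
qed

lemma cmod_eigenvalue_le_mnorm2:
  assumes "A \<in> carrier_mat n n" "eigenvector A v c"
  shows "cmod c \<le> mnorm2 A"
proof -
  have v: "v \<in> carrier_vec n" "v \<noteq> 0\<^sub>v n" "A *\<^sub>v v = c \<cdot>\<^sub>v v"
    using assms by (auto simp: eigenvector_def)
  have "vnorm2 (A *\<^sub>v v) / vnorm2 v \<le> mnorm2 A"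
    using assms v
    by (intro induced_norm_ge[where \<nu> = vnorm2, OF _ vnorm2_nonneg vnorm2_mult_mat_vec_le])
      (auto intro!: sum_nonneg)
  moreover have "vnorm2 v \<noteq> 0" using v by (auto simp: vnorm2_eq_0_iff)
  ultimately show ?thesis using v by (simp add: vnorm2_smult)
qed

text \<open>The same vector is an eigenvector of the q-th power for c^q, so the norm of that single
  power bounds |c|^q. Applied to \<open>\<Psi>\<close>, this makes the geometric series in mu_i
  summable.\<close>

lemma cmod_eigenvalue_less_1:
  assumes A: "A \<in> carrier_mat n n" and ev: "eigenvector A v c" and lt: "mnorm2 (A ^\<^sub>m q) < 1"
  shows "cmod c < 1"
proof -
  have "v \<in> carrier_vec n" "v \<noteq> 0\<^sub>v n" using A ev by (auto simp: eigenvector_def)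
  then have "eigenvector (A ^\<^sub>m q) v (c ^ q)"
    using eigenvector_pow[OF A ev] A unfolding eigenvector_def by auto
  then have "cmod (c ^ q) \<le> mnorm2 (A ^\<^sub>m q)"
    using A by (intro cmod_eigenvalue_le_mnorm2) auto
  then have "cmod c ^ q < 1" using lt by (simp add: norm_power)
  then show ?thesis using one_le_power[of "cmod c" q] by linarith
qed

subsection \<open>Power series with coefficients of constant phase\<close>

text \<open>Writing the modulus on the right-hand side leaves the phase of a vanishing coefficient
  free. The constant \<open>\<gamma>\<close> lets series of different overall phase share one
  \<open>u\<close>, which closure under products requires. The number \<open>s\<close> is the
  l^1-norm of the coefficients.\<close>

definition aligned :: "complex \<Rightarrow> complex fps \<Rightarrow> real \<Rightarrow> bool" where
  "aligned u f s \<longleftrightarrow>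
     (\<exists>\<gamma>. cmod \<gamma> = 1 \<and> (\<forall>j. fps_nth f j = \<gamma> * u ^ j * of_real (cmod (fps_nth f j)))) \<and>
     (\<lambda>j. cmod (fps_nth f j)) sums s"

lemma aligned_const: "aligned u (fps_const c) (cmod c)"
proof -
  \<comment> \<open>Since \<open>sgn 0 = 0\<close> is not unimodular, c = 0 gets the phase
    1.\<close>
  define \<gamma> where "\<gamma> = (if c = 0 then 1 else sgn c)"
  have "cmod \<gamma> = 1" by (simp add: \<gamma>_def norm_sgn)
  moreover have "c = \<gamma> * of_real (cmod c)"
    by (simp add: \<gamma>_def sgn_div_norm scaleR_conv_of_real)
  then have "\<forall>j. fps_nth (fps_const c) j = \<gamma> * u ^ j * of_real (cmod (fps_nth (fps_const c) j))"
    by auto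
  moreover have "(\<lambda>j. cmod (fps_nth (fps_const c) j)) sums cmod c"
    using sums_single[of 0 "\<lambda>_. cmod c"] by (rule sums_cong[THEN iffD1, rotated]) auto
  ultimately show ?thesis unfolding aligned_def by blast
qed

lemma aligned_X:
  assumes "cmod u = 1"
  shows "aligned u fps_X 1"
proof -
  \<comment> \<open>The factor \<open>inverse u\<close> cancels the power \<open>u ^ 1\<close>
    prescribed at the only non-zero coefficient.\<close>
  have "cmod (inverse u) = 1" using assms by (simp add: norm_inverse)
  moreover have "u \<noteq> 0" using assms by auto
  then have "\<forall>j. fps_nth fps_X j = inverse u * u ^ j * of_real (cmod (fps_nth fps_X j))"
    by (simp add: fps_X_def)
  moreover have "(\<lambda>j. cmod (fps_nth fps_X j)) sums 1"
    using sums_single[of 1 "\<lambda>_. 1::real"] by (rule sums_cong[THEN iffD1, rotated]) (auto simp: fps_X_def)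
  ultimately show ?thesis unfolding aligned_def by blast
qed

lemma aligned_geometric:
  assumes "cmod m < 1" "m = u * of_real (cmod m)"
  shows "aligned u (Abs_fps (\<lambda>j. m ^ j)) (1 / (1 - cmod m))"
proof -
  have "m ^ j = 1 * u ^ j * of_real (cmod (m ^ j))" for j
    by (metis assms(2) mult_1 norm_power of_real_power power_mult_distrib)
  moreover have "(\<lambda>j. cmod (m ^ j)) sums (1 / (1 - cmod m))"
    using assms(1) by (simp add: norm_power geometric_sums)
  ultimately show ?thesis
    unfolding aligned_def fps_nth_Abs_fps by (intro conjI exI[of _ 1] allI) (simp, assumption+)
qed

text \<open>All terms of the j-th convolution sum have the phase a b u^j, because u^i u^(j-i) = u^j.
  Their moduli therefore add up, and the Cauchy product of the two series of moduli gives s t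
  exactly, where general series only satisfy an inequality.\<close>

lemma aligned_mult:
  assumes u: "cmod u = 1" and f: "aligned u f s" and g: "aligned u g t"
  shows "aligned u (f * g) (s * t)"
proof -
  obtain a where a: "cmod a = 1" "\<And>j. fps_nth f j = a * u ^ j * of_real (cmod (fps_nth f j))"
    using f unfolding aligned_def by blast
  obtain b where b: "cmod b = 1" "\<And>j. fps_nth g j = b * u ^ j * of_real (cmod (fps_nth g j))"
    using g unfolding aligned_def by blast
  define h where "h j = (\<Sum>i\<le>j. cmod (fps_nth f i) * cmod (fps_nth g (j - i)))" for j
  have fg: "fps_nth (f * g) j = a * b * u ^ j * of_real (h j)" for j
  proof -
    have "fps_nth f i * fps_nth g (j - i) =
        a * b * u ^ j * of_real (cmod (fps_nth f i) * cmod (fps_nth g (j - i)))" if "i \<le> j" for i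
    proof -
      have "u ^ j = u ^ i * u ^ (j - i)" using that by (simp flip: power_add)
      then show ?thesis by (subst a(2), subst b(2)) (simp add: mult_ac)
    qed
    then show ?thesis
      by (simp add: fps_mult_nth atLeast0AtMost h_def sum_distrib_left)
  qed
  have "h j \<ge> 0" for j by (simp add: h_def sum_nonneg)
  then have norm_fg: "cmod (fps_nth (f * g) j) = h j" for j
    using a(1) b(1) u by (simp add: fg norm_mult norm_power)
  have "h sums (s * t)"
    using Cauchy_product_sums[of "\<lambda>j. cmod (fps_nth f j)" "\<lambda>j. cmod (fps_nth g j)"] f g
    by (simp add: aligned_def sums_iff h_def[abs_def])
  moreover have "cmod (a * b) = 1" using a(1) b(1) by (simp add: norm_mult)
  ultimately show ?thesis unfolding aligned_def norm_fg
    using fg by (intro conjI exI[of _ "a * b"]) auto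
qed

lemma aligned_power:
  assumes "cmod u = 1" "aligned u f s"
  shows "aligned u (f ^ p) (s ^ p)"
proof (induction p)
  case 0
  show ?case using aligned_const[of u 1] by simp
next
  case (Suc p)
  then show ?case using aligned_mult[OF assms(1,2)] by simp
qed

lemma aligned_sum_le:
  assumes "aligned u f s" "finite A"
  shows "(\<Sum>j\<in>A. cmod (fps_nth f j)) \<le> s"
  using assms sum_le_suminf[of "\<lambda>j. cmod (fps_nth f j)" A] by (auto simp: aligned_def sums_iff)

lemma aligned_nonneg: "aligned u f s \<Longrightarrow> s \<ge> 0"
  using aligned_sum_le[of u f s "{}"] by simp

(* The phases cancel on the vector u^b: every coordinate of its image is a sum of moduli. *)
lemma aligned_convolution:
  assumes u: "cmod u = 1" and f: "aligned u f s"
  shows "cmod (\<Sum>b\<le>a. fps_nth f (a - b) * u ^ b) = (\<Sum>j\<le>a. cmod (fps_nth f j))"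
proof -
  obtain c where c: "cmod c = 1" "\<And>j. fps_nth f j = c * u ^ j * of_real (cmod (fps_nth f j))"
    using f unfolding aligned_def by blast
  have "fps_nth f (a - b) * u ^ b = c * u ^ a * of_real (cmod (fps_nth f (a - b)))" if "b \<le> a" for b
  proof -
    have "u ^ a = u ^ (a - b) * u ^ b" using that by (simp flip: power_add)
    then show ?thesis by (subst c(2)) (simp add: mult_ac)
  qed
  then have "(\<Sum>b\<le>a. fps_nth f (a - b) * u ^ b) =
      c * u ^ a * of_real (\<Sum>b\<le>a. cmod (fps_nth f (a - b)))"
    by (simp add: sum_distrib_left)
  also have "(\<Sum>b\<le>a. cmod (fps_nth f (a - b))) = (\<Sum>j\<le>a. cmod (fps_nth f j))"
    by (rule sum.reindex_bij_witness[of _ "\<lambda>j. a - j" "\<lambda>j. a - j"]) auto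
  finally show ?thesis using c(1) u
    by (simp add: norm_mult norm_power sum_nonneg del: of_real_sum)
qed

subsection \<open>Block matrices\<close>

lemma block_index_less: "a * n + i < N * n" if "a < N" "i < n" for a i n N :: nat
proof -
  have "a * n + i < Suc a * n" using that by simp
  also have "\<dots> \<le> N * n" using that by (intro mult_le_mono1) simp
  finally show ?thesis .
qed

lemma sum_blocks: "(\<Sum>r<N * n. g r) = (\<Sum>a<N. \<Sum>i<n. g (a * n + i))"
  for g :: "nat \<Rightarrow> 'a :: comm_monoid_add" and N n :: nat
proof -
  have "sum g {a * n..<a * n + n} = (\<Sum>i<n. g (a * n + i))" for a
    by (rule sum.reindex_bij_witness[of _ "\<lambda>i. a * n + i" "\<lambda>r. r - a * n"]) auto
  then show ?thesis by (simp flip: sum.nat_group)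
qed

lemma less_mult_cases:
  fixes r N n :: nat
  assumes "r < N * n"
  obtains a i where "r = a * n + i" "a < N" "i < n"
proof -
  have "n > 0" using assms by (cases n) auto
  then show thesis
    using that[of "r div n" "r mod n"] assms by (auto intro: less_mult_imp_div_less)
qed

lemma eq_mat_blocksI:
  assumes "A \<in> carrier_mat (N * n) (N * n)" "B \<in> carrier_mat (N * n) (N * n)"
    and eq: "\<And>a b i j. a < N \<Longrightarrow> b < N \<Longrightarrow> i < n \<Longrightarrow> j < n \<Longrightarrow>
      A $$ (a * n + i, b * n + j) = B $$ (a * n + i, b * n + j)"
  shows "A = B"
proof (rule eq_matI)
  fix r c assume "r < dim_row B" "c < dim_col B"
  then have "r < N * n" "c < N * n" using assms(2) by auto
  then show "A $$ (r, c) = B $$ (r, c)" by (elim less_mult_cases) (simp add: eq)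
qed (use assms in auto)

lemma mult_mat_blocks:
  fixes A B :: "'a :: semiring_0 mat"
  assumes "A \<in> carrier_mat (N * n) (N * n)" "B \<in> carrier_mat (N * n) (N * n)"
    and "a < N" "b < N" "i < n" "j < n"
  shows "(A * B) $$ (a * n + i, b * n + j) =
    (\<Sum>c<N. \<Sum>l<n. A $$ (a * n + i, c * n + l) * B $$ (c * n + l, b * n + j))"
proof -
  have "(A * B) $$ (a * n + i, b * n + j) =
      (\<Sum>r<N * n. A $$ (a * n + i, r) * B $$ (r, b * n + j))"
    using assms block_index_less[of a N i n] block_index_less[of b N j n]
    by (simp add: scalar_prod_def atLeast0LessThan)
  then show ?thesis by (simp add: sum_blocks)
qed

lemma block_bidiag_carrier [simp]:
  "D \<in> carrier_mat n n \<Longrightarrow> block_bidiag N D S \<in> carrier_mat (N * n) (N * n)"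
  by (auto simp: block_bidiag_def Let_def)

lemma block_bidiag_index:
  assumes "D \<in> carrier_mat n n" "a < N" "b < N" "i < n" "j < n"
  shows "block_bidiag N D S $$ (a * n + i, b * n + j) =
    (if a = b then D $$ (i, j) else if a = Suc b then S $$ (i, j) else 0)"
  using assms block_index_less[of a N i n] block_index_less[of b N j n]
  by (auto simp: block_bidiag_def Let_def simp del: mult_Suc)

text \<open>The Kronecker product I (x) U, encoded as a bidiagonal block matrix with zero
  subdiagonal so that the index rules for those apply.\<close>

definition block_lift :: "nat \<Rightarrow> complex mat \<Rightarrow> complex mat" where
  "block_lift N U = block_bidiag N U (0\<^sub>m (dim_row U) (dim_row U))"

lemma block_lift_carrier [simp]:
  "U \<in> carrier_mat n n \<Longrightarrow> block_lift N U \<in> carrier_mat (N * n) (N * n)"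
  by (simp add: block_lift_def)

lemma block_lift_index:
  assumes "U \<in> carrier_mat n n" "a < N" "b < N" "i < n" "j < n"
  shows "block_lift N U $$ (a * n + i, b * n + j) = (if a = b then U $$ (i, j) else 0)"
  using assms by (simp add: block_lift_def block_bidiag_index)

lemma block_bidiag_mult_lift:
  assumes D: "D \<in> carrier_mat n n" and S: "S \<in> carrier_mat n n" and U: "U \<in> carrier_mat n n"
  shows "block_bidiag N D S * block_lift N U = block_bidiag N (D * U) (S * U)"
proof (rule eq_mat_blocksI[of _ N n])
  fix a b i j assume ab: "a < N" "b < N" and ij: "i < n" "j < n"
  have "(block_bidiag N D S * block_lift N U) $$ (a * n + i, b * n + j) =
    (\<Sum>c<N. \<Sum>l<n. block_bidiag N D S $$ (a * n + i, c * n + l) *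
      block_lift N U $$ (c * n + l, b * n + j))"
    using D U ab ij by (intro mult_mat_blocks) auto
  also have "\<dots> = (\<Sum>c<N. if c = b then \<Sum>l<n. block_bidiag N D S $$ (a * n + i, b * n + l) * U $$ (l, j) else 0)"
    using D U ab ij by (intro sum.cong) (auto simp: block_lift_index)
  also have "\<dots> = (\<Sum>l<n. block_bidiag N D S $$ (a * n + i, b * n + l) * U $$ (l, j))"
    using ab by simp
  also have "\<dots> = (\<Sum>l<n. (if a = b then D $$ (i, l) else if a = Suc b then S $$ (i, l) else 0) * U $$ (l, j))"
    using D ab ij by (intro sum.cong) (auto simp: block_bidiag_index)
  also have "\<dots> = block_bidiag N (D * U) (S * U) $$ (a * n + i, b * n + j)"
    using D S U ab ij
    by (auto simp: block_bidiag_index[OF mult_carrier_mat[OF D U]] scalar_prod_def atLeast0LessThan)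
  finally show "(block_bidiag N D S * block_lift N U) $$ (a * n + i, b * n + j) =
    block_bidiag N (D * U) (S * U) $$ (a * n + i, b * n + j)" .
qed (use assms in \<open>auto intro: mult_carrier_mat[of _ _ "N * n"]\<close>)

lemma block_lift_one: "block_lift N (1\<^sub>m n) = 1\<^sub>m (N * n)"
proof (rule eq_mat_blocksI[of _ N n])
  fix a b i j assume ab: "a < N" "b < N" and ij: "i < n" "j < n"
  have "a * n + i = b * n + j \<longleftrightarrow> a = b \<and> i = j"
    using ij by (metis add_left_cancel div_mult_self3 div_less mod_less mod_mult_self3 add.right_neutral
        bot_nat_0.not_eq_extremum not_less0)
  then show "block_lift N (1\<^sub>m n) $$ (a * n + i, b * n + j) = 1\<^sub>m (N * n) $$ (a * n + i, b * n + j)"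
    using ab ij block_lift_index[of "1\<^sub>m n" n a N b i j] block_index_less[of a N i n]
      block_index_less[of b N j n]
    by auto
qed auto

lemma block_lift_inverse:
  assumes "U \<in> carrier_mat n n" "V \<in> carrier_mat n n" "U * V = 1\<^sub>m n"
  shows "block_lift N U * block_lift N V = 1\<^sub>m (N * n)"
proof -
  have "block_lift N U * block_lift N V = block_bidiag N (U * V) (0\<^sub>m n n * V)"
    using assms block_bidiag_mult_lift[of U n "0\<^sub>m n n" V N] by (simp add: block_lift_def)
  then show ?thesis using assms block_lift_one[of N n] by (simp add: block_lift_def)
qed

(* Block Toeplitz matrices with diagonal blocks: f i is the generating function of the i-th
   diagonal entries of the blocks. *)
definition toeplitz :: "nat \<Rightarrow> nat \<Rightarrow> (nat \<Rightarrow> complex fps) \<Rightarrow> complex mat" where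
  "toeplitz N n f = mat (N * n) (N * n) (\<lambda>(r, c).
     if r mod n = c mod n \<and> c div n \<le> r div n
     then fps_nth (f (r mod n)) (r div n - c div n) else 0)"

lemma toeplitz_carrier [simp]: "toeplitz N n f \<in> carrier_mat (N * n) (N * n)"
  by (simp add: toeplitz_def)

lemma toeplitz_index:
  assumes "a < N" "b < N" "i < n" "j < n"
  shows "toeplitz N n f $$ (a * n + i, b * n + j) =
    (if i = j \<and> b \<le> a then fps_nth (f i) (a - b) else 0)"
  using assms block_index_less[of a N i n] block_index_less[of b N j n]
  by (simp add: toeplitz_def)

lemma toeplitz_one: "toeplitz N n (\<lambda>_. 1) = 1\<^sub>m (N * n)"
  unfolding block_lift_one[symmetric]
  by (rule eq_mat_blocksI[of _ N n]) (auto simp: toeplitz_index block_lift_index)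

lemma toeplitz_diff: "toeplitz N n f - toeplitz N n g = toeplitz N n (\<lambda>i. f i - g i)"
  by (rule eq_mat_blocksI[of _ N n])
    (auto simp: toeplitz_index block_index_less carrier_matD[OF toeplitz_carrier])

text \<open>Truncation to N blocks respects products thanks to triangularity: the block (a, b) of
  the product only involves the indices c from b to a, all below N, and these already give the full
  convolution coefficient of index a - b.\<close>

lemma toeplitz_mult: "toeplitz N n f * toeplitz N n g = toeplitz N n (\<lambda>i. f i * g i)"
proof (rule eq_mat_blocksI[of _ N n])
  fix a b i j assume ab: "a < N" "b < N" and ij: "i < n" "j < n"
  have "(toeplitz N n f * toeplitz N n g) $$ (a * n + i, b * n + j) =
    (\<Sum>c<N. \<Sum>l<n. toeplitz N n f $$ (a * n + i, c * n + l) *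
      toeplitz N n g $$ (c * n + l, b * n + j))"
    using ab ij by (intro mult_mat_blocks) auto
  also have "\<dots> = (\<Sum>c<N. \<Sum>l<n. if l = i then (if c \<le> a then fps_nth (f i) (a - c) else 0) *
      (if i = j \<and> b \<le> c then fps_nth (g i) (c - b) else 0) else 0)"
    using ab ij by (intro sum.cong) (auto simp: toeplitz_index)
  also have "\<dots> = (\<Sum>c<N. (if c \<le> a then fps_nth (f i) (a - c) else 0) *
      (if i = j \<and> b \<le> c then fps_nth (g i) (c - b) else 0))"
    using ij by simp
  also have "\<dots> = (\<Sum>c\<in>{b..a}. fps_nth (f i) (a - c) * (if i = j then fps_nth (g i) (c - b) else 0))"
    using ab by (intro sum.mono_neutral_cong_right) auto
  also have "\<dots> = (if i = j \<and> b \<le> a then fps_nth (f i * g i) (a - b) else 0)"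
  proof (cases "i = j \<and> b \<le> a")
    case True
    have "(\<Sum>c\<in>{b..a}. fps_nth (f i) (a - c) * fps_nth (g i) (c - b)) =
        (\<Sum>k = 0..a - b. fps_nth (f i) k * fps_nth (g i) (a - b - k))"
      using True
      by (intro sum.reindex_bij_witness[of _ "\<lambda>k. a - k" "\<lambda>c. a - c"]) auto
    then show ?thesis using True by (simp add: fps_mult_nth)
  qed auto
  finally show "(toeplitz N n f * toeplitz N n g) $$ (a * n + i, b * n + j) =
      toeplitz N n (\<lambda>i. f i * g i) $$ (a * n + i, b * n + j)"
    using ab ij by (simp add: toeplitz_index)
qed (rule mult_carrier_mat[of _ _ "N * n"], auto)

text \<open>Here \<open>D\<close> and \<open>S\<close> stand for products of a block with
  \<open>U\<close>, whose j-th column is an eigenvalue times the j-th column of \<open>U\<close>. A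
  symbol of degree at most one fills only the diagonal and the first subdiagonal.\<close>

lemma block_lift_mult_toeplitz:
  assumes U: "U \<in> carrier_mat n n" and D: "D \<in> carrier_mat n n"
    and D_eq: "\<And>i j. i < n \<Longrightarrow> j < n \<Longrightarrow> D $$ (i, j) = U $$ (i, j) * d j"
    and S_eq: "\<And>i j. i < n \<Longrightarrow> j < n \<Longrightarrow> S $$ (i, j) = U $$ (i, j) * s j"
  shows "block_lift N U * toeplitz N n (\<lambda>j. fps_const (d j) + fps_const (s j) * fps_X) =
    block_bidiag N D S"
proof (rule eq_mat_blocksI[of _ N n])
  let ?f = "\<lambda>j. fps_const (d j) + fps_const (s j) * fps_X"
  fix a b i j assume ab: "a < N" "b < N" and ij: "i < n" "j < n"
  have "(block_lift N U * toeplitz N n ?f) $$ (a * n + i, b * n + j) =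
    (\<Sum>c<N. \<Sum>l<n. block_lift N U $$ (a * n + i, c * n + l) *
      toeplitz N n ?f $$ (c * n + l, b * n + j))"
    using U ab ij by (intro mult_mat_blocks) auto
  also have "\<dots> = (\<Sum>c<N. if c = a then \<Sum>l<n. if l = j then U $$ (i, j) *
      (if b \<le> a then fps_nth (?f j) (a - b) else 0) else 0 else 0)"
    using U ab ij by (intro sum.cong) (auto simp: block_lift_index toeplitz_index
        if_distrib[of "\<lambda>x. _ * x"] cong: if_cong)
  also have "\<dots> = U $$ (i, j) * (if b \<le> a then fps_nth (?f j) (a - b) else 0)"
    using ab ij by simp
  also have "\<dots> = block_bidiag N D S $$ (a * n + i, b * n + j)"
    using ab ij D by (auto simp: block_bidiag_index[OF D] D_eq S_eq fps_X_def)
  finally show "(block_lift N U * toeplitz N n ?f) $$ (a * n + i, b * n + j) =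
    block_bidiag N D S $$ (a * n + i, b * n + j)" .
qed (use U D in \<open>auto intro: mult_carrier_mat[of _ _ "N * n"]\<close>)

text \<open>The coordinates split into n independent convolutions, one for each position i inside
  the blocks.\<close>

lemma toeplitz_mult_vec:
  assumes x: "x \<in> carrier_vec (N * n)" and "a < N" "i < n"
  shows "(toeplitz N n f *\<^sub>v x) $ (a * n + i) = (\<Sum>b\<le>a. fps_nth (f i) (a - b) * x $ (b * n + i))"
proof -
  have "(toeplitz N n f *\<^sub>v x) $ (a * n + i) =
      (\<Sum>b<N. \<Sum>j<n. toeplitz N n f $$ (a * n + i, b * n + j) * x $ (b * n + j))"
    using assms block_index_less[of a N i n]
    by (simp add: scalar_prod_def atLeast0LessThan sum_blocks carrier_matD[OF toeplitz_carrier]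
        block_index_less)
  also have "\<dots> = (\<Sum>b<N. \<Sum>j<n. if j = i then
      (if b \<le> a then fps_nth (f i) (a - b) else 0) * x $ (b * n + i) else 0)"
    using assms by (intro sum.cong) (auto simp: toeplitz_index)
  also have "\<dots> = (\<Sum>b<N. (if b \<le> a then fps_nth (f i) (a - b) else 0) * x $ (b * n + i))"
    using assms by simp
  also have "\<dots> = (\<Sum>b\<le>a. fps_nth (f i) (a - b) * x $ (b * n + i))"
    using assms by (intro sum.mono_neutral_cong_right) auto
  finally show ?thesis .
qed

lemma vnorm2_power2_blocks:
  assumes "x \<in> carrier_vec (N * n)"
  shows "(vnorm2 x)\<^sup>2 = (\<Sum>a<N. \<Sum>i<n. (cmod (x $ (a * n + i)))\<^sup>2)"
  using assms by (simp add: vnorm2_power2 sum_blocks)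

text \<open>The weighted norm applies the inverse of \<open>U\<close> to every block and thereby
  undoes the lift. Positivity of n lets the division by the block size recover the number of
  blocks.\<close>

lemma vnorm_U_block_lift:
  assumes U: "U \<in> carrier_mat n n" and V: "V \<in> carrier_mat n n"
    and inv: "minv U = V" and VU: "V * U = 1\<^sub>m n" and n: "n > 0"
    and y: "y \<in> carrier_vec (N * n)"
  shows "vnorm_U U (block_lift N U *\<^sub>v y) = vnorm2 y"
proof -
  have blk: "vec_block n (block_lift N U *\<^sub>v y) a = U *\<^sub>v vec_block n y a" if a: "a < N" for a
  proof (rule eq_vecI)
    fix i assume "i < dim_vec (U *\<^sub>v vec_block n y a)"
    then have i: "i < n" using U by simp
    have "(block_lift N U *\<^sub>v y) $ (a * n + i) =
        (\<Sum>b<N. \<Sum>j<n. block_lift N U $$ (a * n + i, b * n + j) * y $ (b * n + j))"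
      using U y i a block_index_less[of a N i n] carrier_matD[OF block_lift_carrier[OF U]]
      by (simp add: scalar_prod_def atLeast0LessThan sum_blocks block_index_less)
    also have "\<dots> = (\<Sum>b<N. if b = a then \<Sum>j<n. U $$ (i, j) * y $ (a * n + j) else 0)"
      using U a i by (intro sum.cong) (auto simp: block_lift_index)
    also have "\<dots> = (\<Sum>j<n. U $$ (i, j) * y $ (a * n + j))" using a by simp
    finally show "vec_block n (block_lift N U *\<^sub>v y) a $ i = (U *\<^sub>v vec_block n y a) $ i"
      using U i by (simp add: vec_block_def scalar_prod_def atLeast0LessThan)
  qed (use U in \<open>auto simp: vec_block_def\<close>)
  have cancel: "V *\<^sub>v (U *\<^sub>v vec_block n y a) = vec_block n y a" for a
  proof -
    have c: "vec_block n y a \<in> carrier_vec n" by (simp add: vec_block_def)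
    show ?thesis using assoc_mult_mat_vec[OF V U c] VU c by simp
  qed
  have "dim_vec (block_lift N U *\<^sub>v y) div dim_row U = N"
    using U n carrier_matD[OF block_lift_carrier[OF U]] by simp
  moreover have "(\<Sum>a<N. (vnorm2 (V *\<^sub>v vec_block n (block_lift N U *\<^sub>v y) a))\<^sup>2) =
      (\<Sum>a<N. (vnorm2 (vec_block n y a))\<^sup>2)"
    by (intro sum.cong) (simp_all add: blk cancel)
  moreover have "\<dots> = (vnorm2 y)\<^sup>2"
    by (subst vnorm2_power2_blocks[OF y]) (simp add: vnorm2_power2 vec_block_def)
  ultimately show ?thesis
    using U inv by (simp add: vnorm_U_def vnorm2_nonneg)
qed

subsection \<open>Norms of Toeplitz matrices\<close>

text \<open>Young's inequality for l^1: after exchanging the sums, the factor of \<open>X b\<close>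
  is a partial sum of the coefficient moduli, hence at most s. In matrix terms, every column sum is
  at most s.\<close>

lemma sum_convolution_le:
  assumes f: "aligned u f s" and X: "\<And>b. X b \<ge> 0"
  shows "(\<Sum>a<N. \<Sum>b\<le>a. cmod (fps_nth f (a - b)) * X b) \<le> s * (\<Sum>b<N. X b)"
proof -
  have "(\<Sum>a<N. \<Sum>b\<le>a. cmod (fps_nth f (a - b)) * X b) =
      (\<Sum>a<N. \<Sum>b<N. if b \<le> a then cmod (fps_nth f (a - b)) * X b else 0)"
    by (intro sum.cong sum.mono_neutral_cong_left) auto
  also have "\<dots> = (\<Sum>b<N. \<Sum>a<N. if b \<le> a then cmod (fps_nth f (a - b)) * X b else 0)"
    by (rule sum.swap)
  also have "\<dots> = (\<Sum>b<N. \<Sum>a\<in>{b..<N}. cmod (fps_nth f (a - b)) * X b)"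
    by (intro sum.cong sum.mono_neutral_cong_right) auto
  also have "\<dots> = (\<Sum>b<N. (\<Sum>a\<in>{b..<N}. cmod (fps_nth f (a - b))) * X b)"
    by (simp add: sum_distrib_right)
  also have "\<dots> = (\<Sum>b<N. (\<Sum>j<N - b. cmod (fps_nth f j)) * X b)"
  proof (rule sum.cong[OF refl])
    fix b
    have "(\<Sum>a\<in>{b..<N}. cmod (fps_nth f (a - b))) = (\<Sum>j<N - b. cmod (fps_nth f j))"
      by (rule sum.reindex_bij_witness[of _ "\<lambda>j. j + b" "\<lambda>a. a - b"]) auto
    then show "(\<Sum>a\<in>{b..<N}. cmod (fps_nth f (a - b))) * X b =
      (\<Sum>j<N - b. cmod (fps_nth f j)) * X b" by simp
  qed
  also have "\<dots> \<le> (\<Sum>b<N. s * X b)"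
    using X by (intro sum_mono mult_right_mono aligned_sum_le[OF f]) auto
  finally show ?thesis by (simp add: sum_distrib_left)
qed

text \<open>Splitting w z as sqrt w times (sqrt w) z keeps one copy of the weight in each factor;
  the Schur test then uses one copy for row sums and the other for column sums.\<close>

lemma weighted_Cauchy_Schwarz:
  fixes w z :: "'a \<Rightarrow> real"
  assumes "\<And>i. i \<in> A \<Longrightarrow> w i \<ge> 0" "\<And>i. i \<in> A \<Longrightarrow> z i \<ge> 0"
  shows "(\<Sum>i\<in>A. w i * z i)\<^sup>2 \<le> (\<Sum>i\<in>A. w i) * (\<Sum>i\<in>A. w i * (z i)\<^sup>2)"
proof -
  have "(\<Sum>i\<in>A. w i * z i) = (\<Sum>i\<in>A. \<bar>sqrt (w i)\<bar> * \<bar>sqrt (w i) * z i\<bar>)"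
    using assms by (intro sum.cong) (auto simp flip: mult.assoc)
  also have "\<dots> \<le> L2_set (\<lambda>i. sqrt (w i)) A * L2_set (\<lambda>i. sqrt (w i) * z i) A"
    by (rule L2_set_mult_ineq)
  finally have "(\<Sum>i\<in>A. w i * z i)\<^sup>2 \<le>
      (L2_set (\<lambda>i. sqrt (w i)) A * L2_set (\<lambda>i. sqrt (w i) * z i) A)\<^sup>2"
    using assms by (intro power_mono) (auto intro!: sum_nonneg)
  also have "\<dots> = (\<Sum>i\<in>A. (sqrt (w i))\<^sup>2) * (\<Sum>i\<in>A. (sqrt (w i) * z i)\<^sup>2)"
    by (simp add: L2_set_def power_mult_distrib sum_nonneg)
  also have "\<dots> = (\<Sum>i\<in>A. w i) * (\<Sum>i\<in>A. w i * (z i)\<^sup>2)"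
    using assms by (intro arg_cong2[where f = "(*)"] sum.cong) (auto simp: power_mult_distrib)
  finally show ?thesis .
qed

text \<open>The Schur test: in \<open>entry\<close> the row sums contribute one factor K, and
  summing over the rows contributes a second one through the column sums, so the squared norm grows
  by at most K^2.\<close>

lemma vnorm2_toeplitz_le:
  assumes f: "\<And>i. i < n \<Longrightarrow> aligned (u i) (f i) (s i)" and K: "\<And>i. i < n \<Longrightarrow> s i \<le> K" "K \<ge> 0"
    and x: "x \<in> carrier_vec (N * n)"
  shows "vnorm2 (toeplitz N n f *\<^sub>v x) \<le> K * vnorm2 x"
proof -
  have y: "toeplitz N n f *\<^sub>v x \<in> carrier_vec (N * n)"
    by (rule mult_mat_vec_carrier[OF toeplitz_carrier x])
  have entry: "(cmod ((toeplitz N n f *\<^sub>v x) $ (a * n + i)))\<^sup>2 \<le>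
      K * (\<Sum>b\<le>a. cmod (fps_nth (f i) (a - b)) * (cmod (x $ (b * n + i)))\<^sup>2)"
    if ai: "a < N" "i < n" for a i
  proof -
    let ?w = "\<lambda>b. cmod (fps_nth (f i) (a - b))"
    have "cmod ((toeplitz N n f *\<^sub>v x) $ (a * n + i)) \<le> (\<Sum>b\<le>a. ?w b * cmod (x $ (b * n + i)))"
      using ai x by (auto simp: toeplitz_mult_vec norm_mult intro!: sum_norm_le)
    then have "(cmod ((toeplitz N n f *\<^sub>v x) $ (a * n + i)))\<^sup>2 \<le>
        (\<Sum>b\<le>a. ?w b * cmod (x $ (b * n + i)))\<^sup>2"
      by (intro power_mono) auto
    also have "\<dots> \<le> (\<Sum>b\<le>a. ?w b) * (\<Sum>b\<le>a. ?w b * (cmod (x $ (b * n + i)))\<^sup>2)"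
      by (rule weighted_Cauchy_Schwarz) auto
    also have "(\<Sum>b\<le>a. ?w b) = (\<Sum>j\<le>a. cmod (fps_nth (f i) j))"
      by (rule sum.reindex_bij_witness[of _ "\<lambda>j. a - j" "\<lambda>j. a - j"]) auto
    also have "\<dots> * (\<Sum>b\<le>a. ?w b * (cmod (x $ (b * n + i)))\<^sup>2) \<le>
        K * (\<Sum>b\<le>a. ?w b * (cmod (x $ (b * n + i)))\<^sup>2)"
      using aligned_sum_le[OF f[OF ai(2)], of "{..a}"] K(1)[OF ai(2)]
      by (intro mult_right_mono) (auto intro!: sum_nonneg)
    finally show ?thesis .
  qed
  have "(vnorm2 (toeplitz N n f *\<^sub>v x))\<^sup>2 \<le>
      (\<Sum>a<N. \<Sum>i<n. K * (\<Sum>b\<le>a. cmod (fps_nth (f i) (a - b)) * (cmod (x $ (b * n + i)))\<^sup>2))"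
    unfolding vnorm2_power2_blocks[OF y] using entry by (intro sum_mono) auto
  also have "\<dots> = K * (\<Sum>i<n. \<Sum>a<N. \<Sum>b\<le>a. cmod (fps_nth (f i) (a - b)) * (cmod (x $ (b * n + i)))\<^sup>2)"
    by (subst sum.swap) (simp add: sum_distrib_left)
  also have "\<dots> \<le> K * (\<Sum>i<n. s i * (\<Sum>b<N. (cmod (x $ (b * n + i)))\<^sup>2))"
    using K f by (intro mult_left_mono sum_mono sum_convolution_le) auto
  also have "\<dots> \<le> K * (\<Sum>i<n. K * (\<Sum>b<N. (cmod (x $ (b * n + i)))\<^sup>2))"
    using K by (intro mult_left_mono sum_mono mult_right_mono) (auto intro!: sum_nonneg)
  also have "\<dots> = K\<^sup>2 * (vnorm2 x)\<^sup>2"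
    unfolding vnorm2_power2_blocks[OF x]
    by (subst sum.swap) (simp add: sum_distrib_left power2_eq_square mult.assoc)
  finally have "(vnorm2 (toeplitz N n f *\<^sub>v x))\<^sup>2 \<le> (K * vnorm2 x)\<^sup>2"
    by (simp add: power_mult_distrib)
  then show ?thesis using K vnorm2_nonneg[of x] by (simp add: power2_le_iff_abs_le vnorm2_nonneg)
qed

lemma mnorm2_toeplitz_ge:
  assumes f: "\<And>i. i < n \<Longrightarrow> aligned (u i) (f i) (s i)" and K: "\<And>i. i < n \<Longrightarrow> s i \<le> K" "K \<ge> 0"
    and i0: "i0 < n" and u: "cmod (u i0) = 1" and m: "m < N"
  shows "sqrt (real (N - m) / real N) * (\<Sum>j\<le>m. cmod (fps_nth (f i0) j)) \<le> mnorm2 (toeplitz N n f)"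
proof -
  \<comment> \<open>The truncated sequence u^b placed in component \<open>i0\<close> alone; its N
    non-zero entries are unimodular, so its squared norm is N.\<close>
  define x where "x = vec (N * n) (\<lambda>r. if r mod n = i0 then u i0 ^ (r div n) else 0)"
  let ?F = "\<lambda>a. \<Sum>j\<le>a. cmod (fps_nth (f i0) j)"
  let ?y = "toeplitz N n f *\<^sub>v x"
  have x: "x \<in> carrier_vec (N * n)" by (simp add: x_def)
  have y: "?y \<in> carrier_vec (N * n)" by (rule mult_mat_vec_carrier[OF toeplitz_carrier x])
  have x_index: "x $ (b * n + i) = (if i = i0 then u i0 ^ b else 0)" if "b < N" "i < n" for b i
    using that block_index_less[of b N i n] by (simp add: x_def)
  have "(vnorm2 x)\<^sup>2 = (\<Sum>b<N. \<Sum>i<n. if i = i0 then 1 else 0)"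
    unfolding vnorm2_power2_blocks[OF x] using u
    by (intro sum.cong) (auto simp: x_index norm_power)
  then have norm_x: "(vnorm2 x)\<^sup>2 = real N" using i0 by simp
  \<comment> \<open>As \<open>?F\<close> is non-decreasing, each of the N - m rows from m on
    contributes at least the square of \<open>?F m\<close>; the earlier rows are discarded.\<close>
  have "real (N - m) * (?F m)\<^sup>2 = (\<Sum>a\<in>{m..<N}. (?F m)\<^sup>2)" by simp
  also have "\<dots> \<le> (\<Sum>a\<in>{m..<N}. (?F a)\<^sup>2)"
    by (intro sum_mono power_mono sum_mono2) (auto intro!: sum_nonneg)
  also have "\<dots> \<le> (\<Sum>a<N. (?F a)\<^sup>2)" by (intro sum_mono2) auto
  also have "\<dots> = (\<Sum>a<N. (cmod (?y $ (a * n + i0)))\<^sup>2)"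
  proof (rule sum.cong[OF refl])
    fix a assume "a \<in> {..<N}"
    then have "a < N" by simp
    then have "?y $ (a * n + i0) = (\<Sum>b\<le>a. fps_nth (f i0) (a - b) * u i0 ^ b)"
      using i0 x by (simp add: toeplitz_mult_vec x_index)
    then show "(?F a)\<^sup>2 = (cmod (?y $ (a * n + i0)))\<^sup>2"
      using aligned_convolution[OF u f[OF i0]] by simp
  qed
  also have "\<dots> \<le> (\<Sum>a<N. \<Sum>i<n. (cmod (?y $ (a * n + i)))\<^sup>2)"
    using i0 by (intro sum_mono member_le_sum) auto
  finally have "real (N - m) * (?F m)\<^sup>2 \<le> (vnorm2 ?y)\<^sup>2"
    unfolding vnorm2_power2_blocks[OF y] .
  then have "real (N - m) / real N * (?F m)\<^sup>2 \<le> (vnorm2 ?y / vnorm2 x)\<^sup>2"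
    using m by (simp add: power_divide norm_x divide_right_mono)
  then have "sqrt (real (N - m) / real N * (?F m)\<^sup>2) \<le> vnorm2 ?y / vnorm2 x"
    by (intro real_le_lsqrt) (auto simp: vnorm2_nonneg)
  moreover have "sqrt ((?F m)\<^sup>2) = ?F m" by (simp add: sum_nonneg)
  ultimately have "sqrt (real (N - m) / real N) * ?F m \<le> vnorm2 ?y / vnorm2 x"
    by (simp only: real_sqrt_mult)
  also have "\<dots> \<le> mnorm2 (toeplitz N n f)"
  proof (rule induced_norm_ge[where \<nu> = vnorm2])
    show "x \<noteq> 0\<^sub>v (dim_col (toeplitz N n f))"
      using norm_x m vnorm2_eq_0_iff[of x] x
      by (auto simp: carrier_matD[OF toeplitz_carrier])
  qed (use K x in \<open>auto simp: vnorm2_nonneg carrier_matD[OF toeplitz_carrier]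
      intro: vnorm2_toeplitz_le[OF f]\<close>)
  finally show ?thesis .
qed

text \<open>Two parameters are sent to infinity in order: for c below the supremum, m is fixed with
  a partial sum above c in a maximal component \<open>i0\<close>, and then N grows until the factor
  sqrt((N - m) / N) no longer spoils the inequality.\<close>

lemma mnorm2_toeplitz_tendsto:
  assumes n: "n > 0" and f: "\<And>i. i < n \<Longrightarrow> aligned (u i) (f i) (s i)"
    and u: "\<And>i. i < n \<Longrightarrow> cmod (u i) = 1"
  shows "(\<lambda>N. mnorm2 (toeplitz N n f)) \<longlonglongrightarrow> (SUP i\<in>{..<n}. s i)"
proof -
  define K where "K = (SUP i\<in>{..<n}. s i)"
  have K_Max: "K = Max (s ` {..<n})"
    using n by (auto simp: K_def intro!: cSup_eq_Max)
  then have s_le: "s i \<le> K" if "i < n" for i using that by simp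
  have "K \<in> s ` {..<n}" unfolding K_Max using n by (intro Max_in) auto
  then obtain i0 where i0: "i0 < n" "s i0 = K" by auto
  have K0: "K \<ge> 0" using aligned_nonneg[OF f[OF i0(1)]] i0 by simp
  have upper: "mnorm2 (toeplitz N n f) \<le> K" if "N > 0" for N
  proof (rule induced_norm_le[where \<nu> = vnorm2])
    show "vnorm2 (toeplitz N n f *\<^sub>v v) \<le> K * vnorm2 v"
      if "v \<in> carrier_vec (dim_col (toeplitz N n f))" for v
      using vnorm2_toeplitz_le[OF f s_le K0] that by (simp add: carrier_matD[OF toeplitz_carrier])
  qed (use that n K0 in \<open>auto simp: vnorm2_nonneg carrier_matD[OF toeplitz_carrier]\<close>)
  show ?thesis unfolding K_def[symmetric]
  proof (rule order_tendstoI)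
    fix c assume "K < c"
    show "\<forall>\<^sub>F N in sequentially. mnorm2 (toeplitz N n f) < c"
      \<comment> \<open>At N = 0 the induced norm is a supremum over the empty set and obeys no
        bound, so only positive N are considered.\<close>
      using eventually_gt_at_top[of 0]
    proof eventually_elim
      case (elim N)
      then show ?case using upper[of N] \<open>K < c\<close> by linarith
    qed
  next
    fix c assume "c < K"
    have "(\<lambda>m. \<Sum>j<m. cmod (fps_nth (f i0) j)) \<longlonglongrightarrow> K"
      using f[OF i0(1)] i0(2) by (simp add: aligned_def sums_def)
    then have "\<forall>\<^sub>F m in sequentially. c < (\<Sum>j<Suc m. cmod (fps_nth (f i0) j))"
      using \<open>c < K\<close> by (intro order_tendstoD(1)) (rule LIMSEQ_Suc)
    then obtain m where m: "c < (\<Sum>j\<le>m. cmod (fps_nth (f i0) j))"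
      unfolding lessThan_Suc_atMost by (auto dest: eventually_happens)
    let ?F = "\<Sum>j\<le>m. cmod (fps_nth (f i0) j)"
    have "(\<lambda>N. 1 - real m / real N) \<longlonglongrightarrow> 1 - 0"
      by (intro tendsto_diff tendsto_const lim_const_over_n)
    moreover have "\<forall>\<^sub>F N in sequentially. 1 - real m / real N = real (N - m) / real N"
      using eventually_gt_at_top[of m] by eventually_elim (simp add: field_simps of_nat_diff)
    ultimately have "(\<lambda>N. real (N - m) / real N) \<longlonglongrightarrow> 1"
      by (simp add: filterlim_cong)
    then have "(\<lambda>N. sqrt (real (N - m) / real N) * ?F) \<longlonglongrightarrow> sqrt 1 * ?F"
      by (intro tendsto_intros)
    then have "\<forall>\<^sub>F N in sequentially. c < sqrt (real (N - m) / real N) * ?F"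
      using m by (intro order_tendstoD(1)) auto
    then show "\<forall>\<^sub>F N in sequentially. c < mnorm2 (toeplitz N n f)"
      using eventually_gt_at_top[of m]
    proof eventually_elim
      case (elim N)
      then show ?case
        using mnorm2_toeplitz_ge[where u = u and f = f and s = s and n = n and K = K and ?i0.0 = i0,
            OF f s_le K0 i0(1) u[OF i0(1)], of m N] by linarith
    qed
  qed
qed

lemma mnorm1_toeplitz_tendsto:
  assumes f: "aligned u f s"
  shows "(\<lambda>N. mnorm1 (toeplitz N 1 (\<lambda>_. f))) \<longlonglongrightarrow> s"
proof -
  have bound: "vnorm1 (toeplitz N 1 (\<lambda>_. f) *\<^sub>v x) \<le> s * vnorm1 x" if x: "x \<in> carrier_vec N" for N x
  proof -
    have "cmod ((toeplitz N 1 (\<lambda>_. f) *\<^sub>v x) $ a) \<le> (\<Sum>b\<le>a. cmod (fps_nth f (a - b)) * cmod (x $ b))"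
      if "a < N" for a
      using that x toeplitz_mult_vec[of x N 1 a 0 "\<lambda>_. f"]
      by (auto simp: norm_mult intro!: sum_norm_le)
    then have "vnorm1 (toeplitz N 1 (\<lambda>_. f) *\<^sub>v x) \<le>
        (\<Sum>a<N. \<Sum>b\<le>a. cmod (fps_nth f (a - b)) * cmod (x $ b))"
      by (auto simp: vnorm1_def carrier_matD[OF toeplitz_carrier] intro!: sum_mono)
    also have "\<dots> \<le> s * (\<Sum>b<N. cmod (x $ b))"
      by (rule sum_convolution_le[OF f]) simp
    finally show ?thesis using x by (simp add: vnorm1_def)
  qed
  have nonneg: "vnorm1 x \<ge> 0" for x by (simp add: vnorm1_def sum_nonneg)
  have le: "mnorm1 (toeplitz N 1 (\<lambda>_. f)) \<le> s" if "N > 0" for N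
    using that bound aligned_nonneg[OF f]
    by (intro induced_norm_le[where \<nu> = vnorm1])
      (auto simp: nonneg carrier_matD[OF toeplitz_carrier])
  have ge: "(\<Sum>j<N. cmod (fps_nth f j)) \<le> mnorm1 (toeplitz N 1 (\<lambda>_. f))" if N: "N > 0" for N
  proof -
    \<comment> \<open>This vector selects the first column, the only one that contains all of the
      first N coefficients.\<close>
    define e where "e = (unit_vec N 0 :: complex vec)"
    have e: "e \<in> carrier_vec N" by (simp add: e_def)
    have e_index: "e $ b = (if b = 0 then 1 else 0)" if "b < N" for b
      using that N by (simp add: e_def unit_vec_def)
    have "(toeplitz N 1 (\<lambda>_. f) *\<^sub>v e) $ a = fps_nth f a" if "a < N" for a
    proof -
      have "(toeplitz N 1 (\<lambda>_. f) *\<^sub>v e) $ a = (\<Sum>b\<le>a. fps_nth f (a - b) * e $ b)"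
        using that e toeplitz_mult_vec[of e N 1 a 0 "\<lambda>_. f"] by simp
      also have "\<dots> = (\<Sum>b\<le>a. if b = 0 then fps_nth f a else 0)"
        using that by (intro sum.cong) (auto simp: e_index)
      finally show ?thesis by simp
    qed
    then have "vnorm1 (toeplitz N 1 (\<lambda>_. f) *\<^sub>v e) = (\<Sum>j<N. cmod (fps_nth f j))"
      by (simp add: vnorm1_def carrier_matD[OF toeplitz_carrier])
    moreover have "vnorm1 e = (\<Sum>b<N. if b = 0 then 1 else 0)"
      unfolding vnorm1_def using e by (intro sum.cong) (auto simp: e_index)
    then have norm_e: "vnorm1 e = 1" using N by simp
    moreover have "e \<noteq> 0\<^sub>v N" using norm_e by (auto simp: vnorm1_def)
    then have "vnorm1 (toeplitz N 1 (\<lambda>_. f) *\<^sub>v e) / vnorm1 e \<le> mnorm1 (toeplitz N 1 (\<lambda>_. f))"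
      using e bound aligned_nonneg[OF f]
      by (intro induced_norm_ge[where \<nu> = vnorm1 and K = s])
        (auto simp: nonneg carrier_matD[OF toeplitz_carrier])
    ultimately show ?thesis by simp
  qed
  have "(\<lambda>N. \<Sum>j<N. cmod (fps_nth f j)) \<longlonglongrightarrow> s" using f by (simp add: aligned_def sums_def)
  then show ?thesis
  proof (rule tendsto_sandwich[OF _ _ _ tendsto_const[of s], rotated 2])
    show "\<forall>\<^sub>F N in sequentially. (\<Sum>j<N. cmod (fps_nth f j)) \<le> mnorm1 (toeplitz N 1 (\<lambda>_. f))"
      using eventually_gt_at_top[of 0] by eventually_elim (rule ge)
    show "\<forall>\<^sub>F N in sequentially. mnorm1 (toeplitz N 1 (\<lambda>_. f)) \<le> s"
      using eventually_gt_at_top[of 0] by eventually_elim (rule le)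
  qed
qed

lemma mnorm_inf_toeplitz_tendsto:
  assumes u: "cmod u = 1" and f: "aligned u f s"
  shows "(\<lambda>N. mnorm_inf (toeplitz N 1 (\<lambda>_. f))) \<longlonglongrightarrow> s"
proof -
  have le_inf: "cmod (x $ b) \<le> vnorm_inf x" if "b < dim_vec x" for x b
    unfolding vnorm_inf_def using that by (intro cSUP_upper) auto
  have inf_le: "vnorm_inf x \<le> K" if "dim_vec x > 0" "\<And>b. b < dim_vec x \<Longrightarrow> cmod (x $ b) \<le> K" for x K
    unfolding vnorm_inf_def using that by (intro cSUP_least) auto
  \<comment> \<open>The supremum norm of the empty vector is unspecified, hence the condition on the
    dimension here and in the facts below.\<close>
  have nonneg: "vnorm_inf x \<ge> 0" if "dim_vec x > 0" for x
    using le_inf[OF that] norm_ge_zero[of "x $ 0"] by linarith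
  have bound: "vnorm_inf (toeplitz N 1 (\<lambda>_. f) *\<^sub>v x) \<le> s * vnorm_inf x"
    if x: "x \<in> carrier_vec N" and N: "N > 0" for N x
  proof (rule inf_le)
    fix a assume "a < dim_vec (toeplitz N 1 (\<lambda>_. f) *\<^sub>v x)"
    then have a: "a < N" by (simp add: carrier_matD[OF toeplitz_carrier])
    have "cmod ((toeplitz N 1 (\<lambda>_. f) *\<^sub>v x) $ a) \<le> (\<Sum>b\<le>a. cmod (fps_nth f (a - b)) * vnorm_inf x)"
      using a x toeplitz_mult_vec[of x N 1 a 0 "\<lambda>_. f"] le_inf
      by (auto simp: norm_mult intro!: sum_norm_le mult_left_mono)
    also have "\<dots> = (\<Sum>j\<le>a. cmod (fps_nth f j)) * vnorm_inf x"
      unfolding sum_distrib_right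
      by (rule sum.reindex_bij_witness[of _ "\<lambda>j. a - j" "\<lambda>j. a - j"]) auto
    also have "\<dots> \<le> s * vnorm_inf x"
      using x N by (intro mult_right_mono aligned_sum_le[OF f] nonneg) auto
    finally show "cmod ((toeplitz N 1 (\<lambda>_. f) *\<^sub>v x) $ a) \<le> s * vnorm_inf x" .
  qed (use N in \<open>simp add: carrier_matD[OF toeplitz_carrier]\<close>)
  have le: "mnorm_inf (toeplitz N 1 (\<lambda>_. f)) \<le> s" if "N > 0" for N
    using that bound aligned_nonneg[OF f]
    by (intro induced_norm_le[where \<nu> = vnorm_inf])
      (auto intro!: nonneg simp: carrier_matD[OF toeplitz_carrier])
  have ge: "(\<Sum>j<N. cmod (fps_nth f j)) \<le> mnorm_inf (toeplitz N 1 (\<lambda>_. f))" if N: "N > 0" for N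
  proof -
    define x where "x = vec N (\<lambda>b. u ^ b)"
    let ?y = "toeplitz N 1 (\<lambda>_. f) *\<^sub>v x"
    have x: "x \<in> carrier_vec N" by (simp add: x_def)
    have "vnorm_inf x \<le> 1" using N u by (intro inf_le) (auto simp: x_def norm_power)
    moreover have "vnorm_inf x \<ge> 1" using le_inf[of 0 x] N by (simp add: x_def)
    ultimately have norm_x: "vnorm_inf x = 1" by simp
    \<comment> \<open>The last row holds all of the first N coefficients, and \<open>x\<close>, of
      supremum norm 1, aligns their phases.\<close>
    have "?y $ (N - 1) = (\<Sum>b\<le>N - 1. fps_nth f (N - 1 - b) * x $ b)"
      using x N toeplitz_mult_vec[of x N 1 "N - 1" 0 "\<lambda>_. f"] by simp
    also have "\<dots> = (\<Sum>b\<le>N - 1. fps_nth f (N - 1 - b) * u ^ b)"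
      using N by (intro sum.cong) (auto simp: x_def)
    finally have "cmod (?y $ (N - 1)) = (\<Sum>j\<le>N - 1. cmod (fps_nth f j))"
      using aligned_convolution[OF u f, of "N - 1"] by simp
    also have "{..N - 1} = {..<N}" using N by auto
    finally have "(\<Sum>j<N. cmod (fps_nth f j)) \<le> vnorm_inf ?y / vnorm_inf x"
      using le_inf[of "N - 1" ?y] N by (simp add: norm_x carrier_matD[OF toeplitz_carrier])
    also have "\<dots> \<le> mnorm_inf (toeplitz N 1 (\<lambda>_. f))"
    proof (rule induced_norm_ge[where \<nu> = vnorm_inf and K = s])
      have "x $ 0 \<noteq> 0\<^sub>v N $ 0" using N by (simp add: x_def)
      then show "x \<noteq> 0\<^sub>v (dim_col (toeplitz N 1 (\<lambda>_. f)))"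
        by (auto simp: carrier_matD[OF toeplitz_carrier])
    qed (use N x bound aligned_nonneg[OF f] in
        \<open>auto intro!: nonneg simp: carrier_matD[OF toeplitz_carrier]\<close>)
    finally show ?thesis .
  qed
  have "(\<lambda>N. \<Sum>j<N. cmod (fps_nth f j)) \<longlonglongrightarrow> s" using f by (simp add: aligned_def sums_def)
  then show ?thesis
  proof (rule tendsto_sandwich[OF _ _ _ tendsto_const[of s], rotated 2])
    show "\<forall>\<^sub>F N in sequentially. (\<Sum>j<N. cmod (fps_nth f j)) \<le> mnorm_inf (toeplitz N 1 (\<lambda>_. f))"
      using eventually_gt_at_top[of 0] by eventually_elim (rule ge)
    show "\<forall>\<^sub>F N in sequentially. mnorm_inf (toeplitz N 1 (\<lambda>_. f)) \<le> s"
      using eventually_gt_at_top[of 0] by eventually_elim (rule le)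
  qed
qed

subsection \<open>Block matrices diagonalized by a common eigenbasis\<close>

lemma minv_eqI:
  assumes A: "A \<in> carrier_mat n n" and B: "B \<in> carrier_mat n n"
    and AB: "A * B = 1\<^sub>m n" and BA: "B * A = 1\<^sub>m n"
  shows "minv A = B"
proof -
  \<comment> \<open>Being a unit of the matrix ring excludes the result \<open>None\<close>;
    uniqueness of inverses then identifies the result with \<open>B\<close>.\<close>
  have "A \<in> Units (ring_mat TYPE(complex) n ())"
    using assms unfolding Units_def by (auto simp: ring_mat_def)
  then obtain C where C: "mat_inverse A = Some C"
    using mat_inverse(1)[OF A, of "()"] by (cases "mat_inverse A") auto
  then have CA: "C * A = 1\<^sub>m n" "C \<in> carrier_mat n n" using mat_inverse(2)[OF A] by auto
  then have "C = C * (A * B)" by (simp add: AB)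
  also have "\<dots> = B" using A B CA by (simp flip: assoc_mult_mat)
  finally show ?thesis using C by simp
qed

lemma invertible_mat_minv:
  assumes A: "A \<in> carrier_mat n n" and inv: "invertible_mat A"
  shows "minv A \<in> carrier_mat n n" "A * minv A = 1\<^sub>m n" "minv A * A = 1\<^sub>m n"
proof -
  obtain B where "A * B = 1\<^sub>m (dim_row A)" "B * A = 1\<^sub>m (dim_row B)"
    using inv unfolding invertible_mat_def inverts_mat_def by blast
  \<comment> \<open>Invertibility only provides two product equations; the shape of \<open>B\<close>
    is read off from the dimensions of both sides.\<close>
  moreover from this have "dim_col B = n" "dim_row B = n"
    using A by (metis carrier_matD index_mult_mat(2,3) index_one_mat(2,3))+
  ultimately have B: "B \<in> carrier_mat n n" "A * B = 1\<^sub>m n" "B * A = 1\<^sub>m n" using A by auto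
  then have "minv A = B" using minv_eqI[OF A] by blast
  then show "minv A \<in> carrier_mat n n" "A * minv A = 1\<^sub>m n" "minv A * A = 1\<^sub>m n"
    using B by auto
qed

text \<open>Only a pair of mutually inverse matrices is fixed; eigenvectors enter in
  \<open>represents_bidiag\<close>. The locale can thus also be instantiated with identity matrices,
  which yields the scalar case.\<close>

locale eigenbasis =
  fixes n :: nat and U V :: "complex mat"
  assumes n: "n > 0" and U: "U \<in> carrier_mat n n" and V: "V \<in> carrier_mat n n"
    and UV: "U * V = 1\<^sub>m n" and VU: "V * U = 1\<^sub>m n"
begin

text \<open>Similarity in intertwining form: with the inverse lift kept out of the equation,
  compatibility with differences and products follows from distributivity and associativity.\<close>

definition represents :: "nat \<Rightarrow> complex mat \<Rightarrow> (nat \<Rightarrow> complex fps) \<Rightarrow> bool" where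
  "represents N M f \<longleftrightarrow> M \<in> carrier_mat (N * n) (N * n) \<and>
     M * block_lift N U = block_lift N U * toeplitz N n f"

lemma lift_carrier: "block_lift N U \<in> carrier_mat (N * n) (N * n)"
  "block_lift N V \<in> carrier_mat (N * n) (N * n)"
  using U V by simp_all

lemma lift_inverse: "block_lift N U * block_lift N V = 1\<^sub>m (N * n)"
  "block_lift N V * block_lift N U = 1\<^sub>m (N * n)"
  using block_lift_inverse U V UV VU by blast+

lemma represents_iff:
  "represents N M f \<longleftrightarrow> M = block_lift N U * toeplitz N n f * block_lift N V"
  (is "_ \<longleftrightarrow> M = ?R")
proof
  note c = lift_carrier[of N] toeplitz_carrier[of N n f]
  assume "represents N M f"
  then have M: "M \<in> carrier_mat (N * n) (N * n)"
    and eq: "M * block_lift N U = block_lift N U * toeplitz N n f"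
    by (auto simp: represents_def)
  have "M = M * (block_lift N U * block_lift N V)" using M by (simp add: lift_inverse)
  then show "M = ?R" using assoc_mult_mat[OF M c(1) c(2)] eq by simp
next
  note c = lift_carrier[of N] toeplitz_carrier[of N n f]
  assume M: "M = ?R"
  have WT: "block_lift N U * toeplitz N n f \<in> carrier_mat (N * n) (N * n)"
    using c by (intro mult_carrier_mat)
  have "M \<in> carrier_mat (N * n) (N * n)" unfolding M using WT c(2) by (rule mult_carrier_mat)
  moreover have "M * block_lift N U = block_lift N U * toeplitz N n f"
    unfolding M assoc_mult_mat[OF WT c(2) c(1)] lift_inverse by (rule right_mult_one_mat[OF WT])
  ultimately show "represents N M f" by (simp add: represents_def)
qed

lemma represents_one: "represents N (1\<^sub>m (N * n)) (\<lambda>_. 1)"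
  using lift_carrier[of N] by (simp add: represents_def toeplitz_one)

lemma represents_diff:
  assumes "represents N A f" "represents N B g"
  shows "represents N (A - B) (\<lambda>i. f i - g i)"
proof -
  note c = lift_carrier(1)[of N] toeplitz_carrier[of N n f] toeplitz_carrier[of N n g]
  have AB: "A \<in> carrier_mat (N * n) (N * n)" "B \<in> carrier_mat (N * n) (N * n)"
    using assms by (auto simp: represents_def)
  have "(A - B) * block_lift N U =
      block_lift N U * toeplitz N n f - block_lift N U * toeplitz N n g"
    using minus_mult_distrib_mat[OF AB c(1)] assms by (simp add: represents_def)
  also have "\<dots> = block_lift N U * toeplitz N n (\<lambda>i. f i - g i)"
    using mult_minus_distrib_mat[OF c] by (simp add: toeplitz_diff)
  finally show ?thesis using AB by (auto simp: represents_def)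
qed

lemma represents_mult:
  assumes "represents N A f" "represents N B g"
  shows "represents N (A * B) (\<lambda>i. f i * g i)"
proof -
  note c = lift_carrier(1)[of N] toeplitz_carrier[of N n f] toeplitz_carrier[of N n g]
  have AB: "A \<in> carrier_mat (N * n) (N * n)" "B \<in> carrier_mat (N * n) (N * n)"
    using assms by (auto simp: represents_def)
  have "A * B * block_lift N U = A * (block_lift N U * toeplitz N n g)"
    using assoc_mult_mat[OF AB c(1)] assms by (simp add: represents_def)
  also have "\<dots> = block_lift N U * toeplitz N n f * toeplitz N n g"
    using assoc_mult_mat[OF AB(1) c(1) c(3)] assms by (simp add: represents_def)
  also have "\<dots> = block_lift N U * toeplitz N n (\<lambda>i. f i * g i)"
    using assoc_mult_mat[OF c] by (simp add: toeplitz_mult)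
  finally show ?thesis using AB by (auto simp: represents_def)
qed

lemma represents_power:
  assumes "represents N A f"
  shows "represents N (A ^\<^sub>m p) (\<lambda>i. f i ^ p)"
proof (induction p)
  case 0
  have "dim_row A = N * n" using assms by (auto simp: represents_def)
  then show ?case using represents_one by simp
next
  case (Suc p)
  then show ?case using represents_mult[OF Suc assms] by (simp add: mult.commute)
qed

text \<open>Inversion moves to power series: the matrix built from g is a two-sided inverse because
  both products have the symbol 1, and only the identity is represented by 1.\<close>

lemma represents_minv:
  assumes A: "represents N A f" and fg: "\<And>i. f i * g i = 1"
  shows "represents N (minv A) g"
proof -
  let ?B = "block_lift N U * toeplitz N n g * block_lift N V"
  have B: "represents N ?B g" by (simp add: represents_iff)
  have gf: "g i * f i = 1" for i using fg[of i] by (simp add: mult.commute)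
  have one: "M = 1\<^sub>m (N * n)" if "represents N M (\<lambda>_. 1)" for M
    using that represents_one unfolding represents_iff by simp
  have "A * ?B = 1\<^sub>m (N * n)" using represents_mult[OF A B] by (intro one) (simp add: fg)
  moreover have "?B * A = 1\<^sub>m (N * n)" using represents_mult[OF B A] by (intro one) (simp add: gf)
  ultimately have "minv A = ?B" using A B by (intro minv_eqI) (auto simp: represents_def)
  then show ?thesis using B by simp
qed

text \<open>Since the columns of \<open>U\<close> are eigenvectors of both blocks, right
  multiplication of a block by \<open>U\<close> merely scales the columns of
  \<open>U\<close>.\<close>

lemma represents_bidiag:
  assumes D: "D \<in> carrier_mat n n" and S: "S \<in> carrier_mat n n"
    and Dd: "\<And>i. i < n \<Longrightarrow> D *\<^sub>v col U i = d i \<cdot>\<^sub>v col U i"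
    and Ss: "\<And>i. i < n \<Longrightarrow> S *\<^sub>v col U i = s i \<cdot>\<^sub>v col U i"
  shows "represents N (block_bidiag N D S) (\<lambda>i. fps_const (d i) + fps_const (s i) * fps_X)"
proof -
  have index: "(M * U) $$ (i, j) = U $$ (i, j) * e j"
    if "M \<in> carrier_mat n n" "M *\<^sub>v col U j = e j \<cdot>\<^sub>v col U j" "i < n" "j < n" for M e i j
  proof -
    have "(M * U) $$ (i, j) = (M *\<^sub>v col U j) $ i" using that(1,3,4) U by simp
    also have "\<dots> = (e j \<cdot>\<^sub>v col U j) $ i" by (simp only: that(2))
    finally show ?thesis using that(3,4) U by simp
  qed
  have "block_lift N U * toeplitz N n (\<lambda>i. fps_const (d i) + fps_const (s i) * fps_X) =
      block_bidiag N (D * U) (S * U)"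
    by (intro block_lift_mult_toeplitz U mult_carrier_mat[OF D U])
      (use D S Dd Ss index in blast)+
  then show ?thesis using block_bidiag_mult_lift[OF D S U] D by (simp add: represents_def)
qed

lemma mnorm_U_eq:
  assumes "represents N M f"
  shows "mnorm_U U M = mnorm2 (toeplitz N n f)"
proof (rule induced_norm_similar)
  show "vnorm_U U (block_lift N U *\<^sub>v y) = vnorm2 y" if "y \<in> carrier_vec (N * n)" for y
    using vnorm_U_block_lift[OF U V _ VU n that] minv_eqI[OF U V UV VU] by simp
qed (use assms lift_carrier[of N] lift_inverse[of N] in \<open>auto simp: represents_def\<close>)

end

section \<open>Symbols of the two error matrices\<close>

definition coarse_symbol :: "nat \<Rightarrow> complex \<Rightarrow> complex \<Rightarrow> complex fps" where
  "coarse_symbol k l m = fps_const (l ^ k - m) * (fps_X * Abs_fps (\<lambda>j. m ^ j))"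

definition fine_symbol :: "nat \<Rightarrow> complex \<Rightarrow> complex \<Rightarrow> complex fps" where
  "fine_symbol k l m = coarse_symbol k l m * (fps_const (l ^ k) * fps_X)"

lemma geometric_fps_inverse:
  "(1 - fps_const m * fps_X) * Abs_fps (\<lambda>j. m ^ j) = (1 :: complex fps)"
proof (rule fps_ext)
  fix j
  show "fps_nth ((1 - fps_const m * fps_X) * Abs_fps (\<lambda>j. m ^ j)) j = fps_nth 1 j"
    by (cases j) (simp_all add: left_diff_distrib mult.assoc fps_X_mult_nth)
qed

text \<open>The right-hand side mirrors the matrix expression, the geometric series standing for the
  inverse of 1 - m X. Replacing the leading 1 by (1 - m X) / (1 - m X) exposes the factored form,
  whose factors are aligned one by one.\<close>

lemma coarse_symbol_eq:
  "coarse_symbol k l m = 1 - (1 - fps_const (l ^ k) * fps_X) * Abs_fps (\<lambda>j. m ^ j)"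
proof -
  let ?g = "Abs_fps (\<lambda>j. m ^ j)"
  have "1 - (1 - fps_const (l ^ k) * fps_X) * ?g =
      (1 - fps_const m * fps_X) * ?g - (1 - fps_const (l ^ k) * fps_X) * ?g"
    by (simp add: geometric_fps_inverse)
  also have "\<dots> = (fps_const (l ^ k) - fps_const m) * (fps_X * ?g)"
    by (simp add: algebra_simps del: fps_const_sub)
  finally show ?thesis by (simp add: coarse_symbol_def)
qed

text \<open>The value 1 at m = 0 keeps the phase unimodular there.\<close>

definition phase :: "complex \<Rightarrow> complex" where
  "phase m = (if m = 0 then 1 else sgn m)"

lemma cmod_phase: "cmod (phase m) = 1"
  by (simp add: phase_def norm_sgn)

lemma phase_mult_cmod: "m = phase m * of_real (cmod m)"
  by (simp add: phase_def sgn_div_norm scaleR_conv_of_real)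

text \<open>The l^1-norms of the three factors multiply: |l^k - m| for the constant, 1 for X and 1 /
  (1 - |m|) for the geometric series.\<close>

lemma aligned_coarse_symbol:
  assumes "cmod m < 1"
  shows "aligned (phase m) (coarse_symbol k l m) (cmod (m - l ^ k) / (1 - cmod m))"
proof -
  have "aligned (phase m) (fps_const (l ^ k - m) * (fps_X * Abs_fps (\<lambda>j. m ^ j)))
      (cmod (l ^ k - m) * (1 * (1 / (1 - cmod m))))"
    using assms phase_mult_cmod
    by (intro aligned_mult aligned_const aligned_X aligned_geometric cmod_phase)
  then show ?thesis by (simp add: coarse_symbol_def norm_minus_commute)
qed

lemma aligned_fine_symbol:
  assumes "cmod m < 1"
  shows "aligned (phase m) (fine_symbol k l m) (cmod (l ^ k) * cmod (m - l ^ k) / (1 - cmod m))"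
proof -
  have "aligned (phase m) (fine_symbol k l m)
      (cmod (m - l ^ k) / (1 - cmod m) * (cmod (l ^ k) * 1))"
    unfolding fine_symbol_def using assms
    by (intro aligned_mult aligned_const aligned_X aligned_coarse_symbol cmod_phase)
  then show ?thesis by (simp add: mult.commute)
qed

lemma (in eigenbasis)
  assumes Phi: "\<Phi> \<in> carrier_mat n n" and Psi: "\<Psi> \<in> carrier_mat n n"
    and eig_Phi: "\<And>i. i < n \<Longrightarrow> eigenvector \<Phi> (col U i) (lam i)"
    and eig_Psi: "\<And>i. i < n \<Longrightarrow> eigenvector \<Psi> (col U i) (mu i)"
  shows represents_coarse_err:
      "represents N (coarse_err N k \<Phi> \<Psi>) (\<lambda>i. coarse_symbol k (lam i) (mu i))"
    and represents_fine_err: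
      "represents N (fine_err N k \<Phi> \<Psi>) (\<lambda>i. fine_symbol k (lam i) (mu i))"
proof -
  have pow: "\<Phi> ^\<^sub>m k \<in> carrier_mat n n" using Phi by simp
  have colU: "col U i \<in> carrier_vec n" for i using col_dim[of U i] unfolding carrier_matD(1)[OF U] .
  have Psi_col: "\<Psi> *\<^sub>v col U i = mu i \<cdot>\<^sub>v col U i" if "i < n" for i
    using eig_Psi[OF that] by (simp add: eigenvector_def)
  have pow_col: "\<Phi> ^\<^sub>m k *\<^sub>v col U i = lam i ^ k \<cdot>\<^sub>v col U i" if "i < n" for i
    using eigenvector_pow[OF Phi eig_Phi[OF that]] .
  have uminus_col: "(- M) *\<^sub>v v = (- c) \<cdot>\<^sub>v v"
    if "M \<in> carrier_mat n n" "v \<in> carrier_vec n" "M *\<^sub>v v = c \<cdot>\<^sub>v v" for M :: "complex mat" and v c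
    using that uminus_mult_mat_vec[of v M] by auto
  have A: "represents N (A_Delta N k \<Phi>) (\<lambda>i. 1 - fps_const (lam i ^ k) * fps_X)"
    using represents_bidiag[of "1\<^sub>m n" "- (\<Phi> ^\<^sub>m k)" "\<lambda>_. 1" "\<lambda>i. - (lam i ^ k)" N]
      pow colU uminus_col[OF pow colU pow_col] Phi
    by (simp add: A_Delta_def flip: fps_const_neg)
  have B: "represents N (B_Delta N \<Psi>) (\<lambda>i. 1 - fps_const (mu i) * fps_X)"
    using represents_bidiag[of "1\<^sub>m n" "- \<Psi>" "\<lambda>_. 1" "\<lambda>i. - mu i" N]
      colU uminus_col[OF Psi colU Psi_col] Psi
    by (simp add: B_Delta_def flip: fps_const_neg)
  have zero_col: "0\<^sub>m n n *\<^sub>v col U i = 0 \<cdot>\<^sub>v col U i" for i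
    by (rule eq_vecI) (use colU[of i] U in auto)
  have C: "represents N (A_cf_ff_fc N k \<Phi>) (\<lambda>i. fps_const (lam i ^ k) * fps_X)"
    using represents_bidiag[of "0\<^sub>m n n" "\<Phi> ^\<^sub>m k" "\<lambda>_. 0" "\<lambda>i. lam i ^ k" N]
      pow zero_col pow_col Phi
    by (simp add: A_cf_ff_fc_def)
  show coarse: "represents N (coarse_err N k \<Phi> \<Psi>) (\<lambda>i. coarse_symbol k (lam i) (mu i))"
    unfolding coarse_err_def coarse_symbol_eq carrier_matD(1)[OF Phi]
    by (intro represents_diff represents_one represents_mult A represents_minv[OF B]
        geometric_fps_inverse)
  show "represents N (fine_err N k \<Phi> \<Psi>) (\<lambda>i. fine_symbol k (lam i) (mu i))"
    unfolding fine_err_def fine_symbol_def by (intro represents_mult coarse C)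
qed

text \<open>Powers of a matrix have powers of symbols, whose l^1-norms are exactly
  \<open>s i ^ p\<close>. As the \<open>s i\<close> are non-negative, one index \<open>i0\<close>
  maximises both \<open>s i\<close> and \<open>s i ^ p\<close>, so supremum and power
  commute.\<close>

lemma (in eigenbasis) mnorm_U_power_tendsto:
  assumes M: "\<And>N. represents N (M N) f"
    and f: "\<And>i. i < n \<Longrightarrow> aligned (u i) (f i) (s i)" and u: "\<And>i. i < n \<Longrightarrow> cmod (u i) = 1"
  shows "(\<lambda>N. mnorm_U U (M N ^\<^sub>m p)) \<longlonglongrightarrow> (SUP i\<in>{..<n}. s i) ^ p"
    and "(\<lambda>N. mnorm_U U (M N) ^ p) \<longlonglongrightarrow> (SUP i\<in>{..<n}. s i) ^ p"
proof -
  have s: "s i \<ge> 0" if "i < n" for i using aligned_nonneg[OF f[OF that]] .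
  have ne: "s ` {..<n} \<noteq> {}" using n by auto
  have "(SUP i\<in>{..<n}. s i) \<in> s ` {..<n}"
    using Max_in[OF _ ne] by (simp add: cSup_eq_Max[OF _ ne])
  then obtain i0 where i0: "i0 < n" "s i0 = (SUP i\<in>{..<n}. s i)" by auto
  have le: "s i \<le> s i0" if "i < n" for i unfolding i0(2) using that by (intro cSUP_upper) auto
  have "(SUP i\<in>{..<n}. s i ^ p) = s i0 ^ p"
    using i0(1) le s by (intro cSup_eq_maximum) (auto intro!: power_mono)
  moreover have "(\<lambda>N. mnorm2 (toeplitz N n (\<lambda>i. f i ^ p))) \<longlonglongrightarrow> (SUP i\<in>{..<n}. s i ^ p)"
    using n f u by (intro mnorm2_toeplitz_tendsto[of n u] aligned_power) auto
  ultimately show "(\<lambda>N. mnorm_U U (M N ^\<^sub>m p)) \<longlonglongrightarrow> (SUP i\<in>{..<n}. s i) ^ p"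
    using mnorm_U_eq[OF represents_power[OF M]] i0 by simp
  have "(\<lambda>N. mnorm2 (toeplitz N n f)) \<longlonglongrightarrow> (SUP i\<in>{..<n}. s i)"
    using n f u by (intro mnorm2_toeplitz_tendsto)
  then show "(\<lambda>N. mnorm_U U (M N) ^ p) \<longlonglongrightarrow> (SUP i\<in>{..<n}. s i) ^ p"
    using mnorm_U_eq[OF M] by (intro tendsto_power) simp
qed

lemma scalar_norms_tendsto:
  assumes u: "cmod u = 1" and f: "aligned u f s"
  shows "\<exists>L. (\<lambda>N. (mnorm2 (toeplitz N 1 (\<lambda>_. f)))\<^sup>2) \<longlonglongrightarrow> L \<and>
    (\<lambda>N. mnorm1 (toeplitz N 1 (\<lambda>_. f)) * mnorm_inf (toeplitz N 1 (\<lambda>_. f))) \<longlonglongrightarrow> L"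
proof (intro exI conjI)
  have "(\<lambda>N. mnorm2 (toeplitz N 1 (\<lambda>_. f))) \<longlonglongrightarrow> (SUP i\<in>{..<1::nat}. s)"
    using u f by (intro mnorm2_toeplitz_tendsto[where u = "\<lambda>_. u"]) auto
  then have "(\<lambda>N. mnorm2 (toeplitz N 1 (\<lambda>_. f))) \<longlonglongrightarrow> s"
    by (simp add: lessThan_Suc)
  then show "(\<lambda>N. (mnorm2 (toeplitz N 1 (\<lambda>_. f)))\<^sup>2) \<longlonglongrightarrow> s * s"
    unfolding power2_eq_square by (intro tendsto_mult)
  show "(\<lambda>N. mnorm1 (toeplitz N 1 (\<lambda>_. f)) * mnorm_inf (toeplitz N 1 (\<lambda>_. f))) \<longlonglongrightarrow> s * s"
    by (intro tendsto_mult mnorm1_toeplitz_tendsto[OF f] mnorm_inf_toeplitz_tendsto[OF u f])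
qed

text \<open>The scalar matrices are the case of block size 1 with U = 1: a 1 x 1 matrix has its
  entry as eigenvalue, and the lift of the identity is the identity, so that similarity becomes
  equality.\<close>

lemma coarse_err_at_eq: "coarse_err_at N k l m = toeplitz N 1 (\<lambda>_. coarse_symbol k l m)"
  and fine_err_at_eq: "fine_err_at N k l m = toeplitz N 1 (\<lambda>_. fine_symbol k l m)"
proof -
  interpret eigenbasis 1 "1\<^sub>m 1" "1\<^sub>m 1" by unfold_locales auto
  have eig: "eigenvector (scalar_block c) (col (1\<^sub>m 1) i) c" if "i < 1" for c i
  proof -
    have col: "col (1\<^sub>m 1) i = (vec 1 (\<lambda>_. 1) :: complex vec)"
      using that by (intro eq_vecI) auto
    have "scalar_block c *\<^sub>v vec 1 (\<lambda>_. 1) = c \<cdot>\<^sub>v vec 1 (\<lambda>_. 1)"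
      by (rule eq_vecI) (auto simp: scalar_block_def scalar_prod_def)
    moreover have "vec 1 (\<lambda>_. 1) $ 0 \<noteq> (0\<^sub>v 1 :: complex vec) $ 0" by simp
    then have "vec 1 (\<lambda>_. 1) \<noteq> (0\<^sub>v 1 :: complex vec)" by metis
    ultimately show ?thesis
      unfolding eigenvector_def col by (simp add: scalar_block_def)
  qed
  have carrier: "scalar_block c \<in> carrier_mat 1 1" for c by (simp add: scalar_block_def)
  have eq: "M = toeplitz N 1 f" if "represents N M f" for M f
  proof -
    have "block_lift N (1\<^sub>m 1) = 1\<^sub>m (N * 1)" by (rule block_lift_one)
    then have "M \<in> carrier_mat (N * 1) (N * 1)" "M * 1\<^sub>m (N * 1) = 1\<^sub>m (N * 1) * toeplitz N 1 f"
      using that by (simp_all only: represents_def)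
    then show ?thesis
      by (simp only: right_mult_one_mat left_mult_one_mat[OF toeplitz_carrier])
  qed
  show "coarse_err_at N k l m = toeplitz N 1 (\<lambda>_. coarse_symbol k l m)"
    unfolding coarse_err_at_def using eig carrier
    by (intro eq represents_coarse_err[of _ _ "\<lambda>_. l" "\<lambda>_. m"])
  show "fine_err_at N k l m = toeplitz N 1 (\<lambda>_. fine_symbol k l m)"
    unfolding fine_err_at_def using eig carrier
    by (intro eq represents_fine_err[of _ _ "\<lambda>_. l" "\<lambda>_. m"])
qed

theorem corollary5p5:
  fixes \<Phi> \<Psi> U :: "complex mat" and lam mu :: "nat \<Rightarrow> complex" and Nx k q :: nat
  assumes Nx: "Nx \<ge> 1" and k: "k \<ge> 1"
    and dims: "\<Phi> \<in> carrier_mat Nx Nx" "\<Psi> \<in> carrier_mat Nx Nx" "U \<in> carrier_mat Nx Nx"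
    and inv: "invertible_mat \<Phi>" "invertible_mat \<Psi>"
    and q: "q \<ge> 1" "mnorm2 (\<Phi> ^\<^sub>m q) < 1" "mnorm2 (\<Psi> ^\<^sub>m q) < 1"
    and comm: "\<Phi> * \<Psi> = \<Psi> * \<Phi>"
    and U: "invertible_mat U"
    and eig_Phi: "\<And>i. i < Nx \<Longrightarrow> eigenvector \<Phi> (col U i) (lam i)"
    and eig_Psi: "\<And>i. i < Nx \<Longrightarrow> eigenvector \<Psi> (col U i) (mu i)"
  shows
    "(\<forall>i<Nx. \<exists>L.
        (\<lambda>Nc. (mnorm2 (coarse_err_at Nc k (lam i) (mu i)))\<^sup>2) \<longlonglongrightarrow> L \<and>
        (\<lambda>Nc. mnorm1 (coarse_err_at Nc k (lam i) (mu i)) *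
               mnorm_inf (coarse_err_at Nc k (lam i) (mu i))) \<longlonglongrightarrow> L) \<and>
     (\<forall>i<Nx. \<exists>L.
        (\<lambda>Nc. (mnorm2 (fine_err_at Nc k (lam i) (mu i)))\<^sup>2) \<longlonglongrightarrow> L \<and>
        (\<lambda>Nc. mnorm1 (fine_err_at Nc k (lam i) (mu i)) *
               mnorm_inf (fine_err_at Nc k (lam i) (mu i))) \<longlonglongrightarrow> L) \<and>
     (\<forall>p::nat. p \<ge> 1 \<longrightarrow>
        (\<lambda>Nc. mnorm_U U (coarse_err Nc k \<Phi> \<Psi> ^\<^sub>m p)) \<longlonglongrightarrow>
          (SUP i\<in>{..<Nx}. cmod (mu i - lam i ^ k) / (1 - cmod (mu i))) ^ p \<and>
        (\<lambda>Nc. mnorm_U U (coarse_err Nc k \<Phi> \<Psi>) ^ p) \<longlonglongrightarrow>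
          (SUP i\<in>{..<Nx}. cmod (mu i - lam i ^ k) / (1 - cmod (mu i))) ^ p \<and>
        (\<lambda>Nc. mnorm_U U (fine_err Nc k \<Phi> \<Psi> ^\<^sub>m p)) \<longlonglongrightarrow>
          (SUP i\<in>{..<Nx}. cmod (lam i ^ k) * cmod (mu i - lam i ^ k) / (1 - cmod (mu i))) ^ p \<and>
        (\<lambda>Nc. mnorm_U U (fine_err Nc k \<Phi> \<Psi>) ^ p) \<longlonglongrightarrow>
          (SUP i\<in>{..<Nx}. cmod (lam i ^ k) * cmod (mu i - lam i ^ k) / (1 - cmod (mu i))) ^ p)"
proof -
  note V = invertible_mat_minv[OF dims(3) U]
  interpret eigenbasis Nx U "minv U"
    using Nx dims(3) V by unfold_locales auto
  \<comment> \<open>The contraction bound on the power of \<open>\<Psi>\<close> makes every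
    denominator 1 - |mu_i| positive and every symbol summable.\<close>
  have mu: "cmod (mu i) < 1" if "i < Nx" for i
    using cmod_eigenvalue_less_1[OF dims(2) eig_Psi[OF that] q(3)] .
  note coarse = mnorm_U_power_tendsto[OF represents_coarse_err[OF dims(1,2) eig_Phi eig_Psi]
      aligned_coarse_symbol[OF mu] cmod_phase]
  note fine = mnorm_U_power_tendsto[OF represents_fine_err[OF dims(1,2) eig_Phi eig_Psi]
      aligned_fine_symbol[OF mu] cmod_phase]
  show ?thesis
    unfolding coarse_err_at_eq fine_err_at_eq
    by (intro conjI allI impI coarse fine
        scalar_norms_tendsto[OF cmod_phase aligned_coarse_symbol[OF mu]]
        scalar_norms_tendsto[OF cmod_phase aligned_fine_symbol[OF mu]])
qed

end
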